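(* The Dirichlet energy functional $\mathcal E^D(\varphi)=\int_M|\delta\varphi|^2\,\mathrm{vol}$ on $\mathcal M$ is convex at torsion free $G_2$-structures: for every smooth path $\varphi(t)$ in $\mathcal M$ with $\varphi(0)$ torsion free, $\frac{d^2}{dt^2}\big|_{t=0}\mathcal E^D(\varphi(t))\ge0$.
   Context: $M$ is a compact oriented smooth 7-manifold. A 3-form $\varphi$ on $M$ is positive (a $G_2$-structure) if the $\Lambda^7T^*M$-valued quadratic form $Q_\varphi(a,b)=(a\lrcorner\varphi)\wedge(b\lrcorner\varphi)\wedge\varphi$ is positive definite; it determines a unique Riemannian metric $g=g_\varphi$ with $6g_\varphi=*_\varphi Q_\varphi$, Hodge star $*=*_\varphi$, volume form $\mathrm{vol}=*1$, and codifferential $\delta=(-1)^k*d*$ on $k$-forms, all depending on $\varphi$. Fix $c\in H^3(M)$; $\mathcal M$ is the (assumed non-empty) space of closed positive 3-forms in the class $c$. $\varphi$ is torsion free if $d\varphi=0$ and $\delta\varphi=0$. The form norm is $|\tau|^2=g(\tau,\tau)=\frac12\tau_{ij}\tau^{ij}$ for a 2-form $\tau$. *)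

theory Defs
  imports "HOL-Analysis.Analysis"
begin

section \<open>Smooth functions on open subsets of normed spaces\<close>

text \<open>Only meant for open sets: the derivatives are two-sided.\<close>

primrec C_on :: "nat \<Rightarrow> 'a::real_normed_vector set \<Rightarrow> ('a \<Rightarrow> 'b::real_normed_vector) \<Rightarrow> bool" where
  "C_on 0 S f \<longleftrightarrow> continuous_on S f"
| "C_on (Suc n) S f \<longleftrightarrow>
     (\<forall>x\<in>S. f differentiable (at x)) \<and> (\<forall>v. C_on n S (\<lambda>x. frechet_derivative f (at x) v))"

definition smooth_on :: "'a::real_normed_vector set \<Rightarrow> ('a \<Rightarrow> 'b::real_normed_vector) \<Rightarrow> bool" where
  "smooth_on S f \<longleftrightarrow> (\<forall>n. C_on n S f)"


section \<open>Exterior algebra of \<open>\<real>\<^sup>7\<close>\<close>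

text \<open>A \<open>k\<close>-form is a real function of a sequence of vectors which depends on the first \<open>k\<close> of
  them only. The standard basis is indexed by \<open>0,\<dots>,6\<close> through \<open>of_nat :: nat \<Rightarrow> 7\<close>.\<close>

type_synonym vec7 = "real^7"
type_synonym form7 = "(nat \<Rightarrow> vec7) \<Rightarrow> real"

definition std_basis :: "nat \<Rightarrow> vec7" where
  "std_basis a = axis (of_nat a) 1"

definition alternating_form :: "nat \<Rightarrow> form7 \<Rightarrow> bool" where
  "alternating_form k \<alpha> \<longleftrightarrow>
     (\<forall>v w. (\<forall>i<k. v i = w i) \<longrightarrow> \<alpha> v = \<alpha> w) \<and>
     (\<forall>v. \<forall>i<k. linear (\<lambda>u. \<alpha> (v(i := u)))) \<and>
     (\<forall>v. \<forall>i<k. \<forall>j<k. i \<noteq> j \<and> v i = v j \<longrightarrow> \<alpha> v = 0)"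

definition wedge :: "nat \<Rightarrow> nat \<Rightarrow> form7 \<Rightarrow> form7 \<Rightarrow> form7" where
  "wedge k l \<alpha> \<beta> v =
     (\<Sum>p | p permutes {..<k + l}.
        of_int (sign p) * \<alpha> (\<lambda>i. v (p i)) * \<beta> (\<lambda>i. v (p (k + i)))) / (fact k * fact l)"

definition contract :: "vec7 \<Rightarrow> form7 \<Rightarrow> form7" where
  "contract a \<alpha> v = \<alpha> (case_nat a v)"

definition std_vol :: form7 where
  "std_vol v = det (\<chi> i. v (inv_into {..<7} of_nat i))"

text \<open>An inner product on \<open>\<real>\<^sup>7\<close> is given by its Gram matrix \<open>G\<close>, \<open>g(a,b) = a \<bullet> (G *v b)\<close>; the
  entries of \<open>matrix_inv G\<close> are the \<open>g\<^sup>i\<^sup>j\<close>. The orientation is the standard one.\<close>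

definition inner_product_matrix :: "real^7^7 \<Rightarrow> bool" where
  "inner_product_matrix G \<longleftrightarrow> transpose G = G \<and> (\<forall>v. v \<noteq> 0 \<longrightarrow> v \<bullet> (G *v v) > 0)"

definition riem_vol :: "real^7^7 \<Rightarrow> form7" where
  "riem_vol G v = sqrt (det G) * std_vol v"

definition multi_index :: "nat \<Rightarrow> (nat \<Rightarrow> 7) set" where
  "multi_index k = {..<k} \<rightarrow>\<^sub>E UNIV"

text \<open>\<open>\<langle>\<alpha>,\<beta>\<rangle> = 1/k! \<alpha>\<^bsub>i\<^sub>1\<dots>i\<^sub>k\<^esub> \<beta>\<^bsup>i\<^sub>1\<dots>i\<^sub>k\<^esup>\<close>\<close>

definition form_inner :: "real^7^7 \<Rightarrow> nat \<Rightarrow> form7 \<Rightarrow> form7 \<Rightarrow> real" where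
  "form_inner G k \<alpha> \<beta> =
     (\<Sum>i\<in>multi_index k. \<Sum>j\<in>multi_index k.
        (\<Prod>a<k. matrix_inv G $ i a $ j a) *
        \<alpha> (\<lambda>a. axis (i a) 1) * \<beta> (\<lambda>a. axis (j a) 1)) / fact k"

text \<open>\<open>(*\<alpha>)\<^bsub>m\<^sub>1\<dots>\<^esub> = 1/k! \<alpha>\<^bsup>j\<^sub>1\<dots>j\<^sub>k\<^esup> vol\<^bsub>j\<^sub>1\<dots>j\<^sub>k m\<^sub>1\<dots>\<^esub>\<close>, which is the convention
  \<open>\<beta> \<and> *\<alpha> = \<langle>\<beta>,\<alpha>\<rangle> vol\<close>.\<close>

definition hodge_star :: "real^7^7 \<Rightarrow> nat \<Rightarrow> form7 \<Rightarrow> form7" where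
  "hodge_star G k \<alpha> w =
     (\<Sum>i\<in>multi_index k. \<Sum>j\<in>multi_index k.
        (\<Prod>a<k. matrix_inv G $ i a $ j a) *
        \<alpha> (\<lambda>a. axis (i a) 1) * riem_vol G (\<lambda>a. if a < k then axis (j a) 1 else w (a - k))) / fact k"

lemma hodge_star_one: "hodge_star G 0 (\<lambda>_. 1) = riem_vol G"
  by (simp add: hodge_star_def multi_index_def fun_eq_iff)


section \<open>Positive 3-forms on \<open>\<real>\<^sup>7\<close> and their metrics\<close>

definition Q_form :: "form7 \<Rightarrow> vec7 \<Rightarrow> vec7 \<Rightarrow> form7" where
  "Q_form \<phi> a b = wedge 4 3 (wedge 2 2 (contract a \<phi>) (contract b \<phi>)) \<phi>"

text \<open>Positivity of a 7-form is with respect to the standard orientation.\<close>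

definition positive_3form :: "form7 \<Rightarrow> bool" where
  "positive_3form \<phi> \<longleftrightarrow> (\<forall>a. a \<noteq> 0 \<longrightarrow> Q_form \<phi> a a std_basis > 0)"

text \<open>\<open>6 g = *Q\<close>, where the star is the one of \<open>g\<close> itself. A 0-form ignores its argument, so
  evaluating at \<open>\<lambda>_. 0\<close> just extracts its value.\<close>

definition G2_metric :: "form7 \<Rightarrow> real^7^7" where
  "G2_metric \<phi> = (THE G. inner_product_matrix G \<and>
     (\<forall>a b. 6 * (a \<bullet> (G *v b)) = hodge_star G 7 (Q_form \<phi> a b) (\<lambda>_. 0)))"


section \<open>Oriented smooth 7-manifolds\<close>

type_synonym 'm chart = "'m set \<times> ('m \<Rightarrow> vec7)"

abbreviation chart_dom :: "'m chart \<Rightarrow> 'm set" where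
  "chart_dom c \<equiv> fst c"

definition chart_img :: "'m chart \<Rightarrow> vec7 set" where
  "chart_img c = snd c ` fst c"

definition chart_inv :: "'m chart \<Rightarrow> vec7 \<Rightarrow> 'm" where
  "chart_inv c = inv_into (fst c) (snd c)"

definition transition :: "'m chart \<Rightarrow> 'm chart \<Rightarrow> vec7 \<Rightarrow> vec7" where
  "transition c c' = snd c' \<circ> chart_inv c"

definition transition_dom :: "'m chart \<Rightarrow> 'm chart \<Rightarrow> vec7 set" where
  "transition_dom c c' = snd c ` (fst c \<inter> fst c')"

definition is_chart :: "'m::topological_space chart \<Rightarrow> bool" where
  "is_chart c \<longleftrightarrow> open (chart_dom c) \<and> open (chart_img c) \<and>
     homeomorphism (chart_dom c) (chart_img c) (snd c) (chart_inv c)"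

definition oriented_smooth_atlas :: "'m::topological_space chart set \<Rightarrow> bool" where
  "oriented_smooth_atlas A \<longleftrightarrow>
     (\<forall>c\<in>A. is_chart c) \<and> (\<Union>c\<in>A. chart_dom c) = UNIV \<and>
     (\<forall>c\<in>A. \<forall>c'\<in>A. smooth_on (transition_dom c c') (transition c c') \<and>
        (\<forall>x\<in>transition_dom c c'. det (matrix (frechet_derivative (transition c c') (at x))) > 0))"


section \<open>Differential forms\<close>

text \<open>A differential form is the family of its local representatives in the charts of the atlas,
  compatible under pull-back along the transition maps. Values at charts outside the atlas or at
  points outside the image of a chart are irrelevant.\<close>

type_synonym 'm dform = "'m chart \<Rightarrow> vec7 \<Rightarrow> form7"

definition differential_form :: "'m chart set \<Rightarrow> nat \<Rightarrow> 'm dform \<Rightarrow> bool" where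
  "differential_form A k \<omega> \<longleftrightarrow>
     (\<forall>c\<in>A. (\<forall>x\<in>chart_img c. alternating_form k (\<omega> c x)) \<and>
              (\<forall>v. smooth_on (chart_img c) (\<lambda>x. \<omega> c x v))) \<and>
     (\<forall>c\<in>A. \<forall>c'\<in>A. \<forall>x\<in>transition_dom c c'. \<forall>v.
        \<omega> c x v = \<omega> c' (transition c c' x) (\<lambda>i. frechet_derivative (transition c c') (at x) (v i)))"

definition dform_eq :: "'m chart set \<Rightarrow> 'm dform \<Rightarrow> 'm dform \<Rightarrow> bool" where
  "dform_eq A \<omega> \<eta> \<longleftrightarrow> (\<forall>c\<in>A. \<forall>x\<in>chart_img c. \<forall>v. \<omega> c x v = \<eta> c x v)"

text \<open>\<open>(d\<omega>)(v\<^sub>0,\<dots>,v\<^sub>k) = \<Sum>\<^sub>i (-1)\<^sup>i (D\<^bsub>v\<^sub>i\<^esub> \<omega>)(v\<^sub>0,\<dots>,v\<^bsub>i-1\<^esub>,v\<^bsub>i+1\<^esub>,\<dots>,v\<^sub>k)\<close>\<close>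

definition ext_deriv :: "nat \<Rightarrow> 'm dform \<Rightarrow> 'm dform" where
  "ext_deriv k \<omega> c x v =
     (\<Sum>i\<le>k. (-1)^i *
        frechet_derivative (\<lambda>y. \<omega> c y (\<lambda>j. v (if j < i then j else Suc j))) (at x) (v i))"

definition closed_dform :: "'m chart set \<Rightarrow> nat \<Rightarrow> 'm dform \<Rightarrow> bool" where
  "closed_dform A k \<omega> \<longleftrightarrow>
     differential_form A k \<omega> \<and> dform_eq A (ext_deriv k \<omega>) (\<lambda>_ _ _. 0)"

definition exact_dform :: "'m chart set \<Rightarrow> nat \<Rightarrow> 'm dform \<Rightarrow> bool" where
  "exact_dform A k \<omega> \<longleftrightarrow>
     (case k of 0 \<Rightarrow> dform_eq A \<omega> (\<lambda>_ _ _. 0)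
      | Suc j \<Rightarrow> (\<exists>\<eta>. differential_form A j \<eta> \<and> dform_eq A \<omega> (ext_deriv j \<eta>)))"

definition deRham_cohomology :: "'m chart set \<Rightarrow> nat \<Rightarrow> 'm dform set set" where
  "deRham_cohomology A k = {\<omega>. closed_dform A k \<omega>} //
     {(\<omega>, \<omega>'). closed_dform A k \<omega> \<and> closed_dform A k \<omega>' \<and>
        exact_dform A k (\<lambda>c x v. \<omega>' c x v - \<omega> c x v)}"


section \<open>Integration of 7-forms\<close>

definition partition_of_unity ::
  "'m::topological_space chart set \<Rightarrow> 'm chart set \<Rightarrow> ('m chart \<Rightarrow> 'm \<Rightarrow> real) \<Rightarrow> bool" where
  "partition_of_unity A C \<rho> \<longleftrightarrow>
     finite C \<and> C \<subseteq> A \<and>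
     (\<forall>c\<in>C. continuous_on UNIV (\<rho> c) \<and> (\<forall>p. \<rho> c p \<ge> 0) \<and>
        closure {p. \<rho> c p \<noteq> 0} \<subseteq> chart_dom c) \<and>
     (\<forall>p. (\<Sum>c\<in>C. \<rho> c p) = 1)"

text \<open>On a compact manifold a finite partition of unity subordinate to the atlas exists, and the
  integral of a 7-form does not depend on which one is chosen.\<close>

definition dform_integral :: "'m::topological_space chart set \<Rightarrow> 'm dform \<Rightarrow> real" where
  "dform_integral A \<omega> =
     (let (C, \<rho>) = (SOME (C, \<rho>). partition_of_unity A C \<rho>)
      in \<Sum>c\<in>C. integral (chart_img c) (\<lambda>x. \<rho> c (chart_inv c x) * \<omega> c x std_basis))"


section \<open>\<open>G\<^sub>2\<close>-structures and the Dirichlet energy\<close>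

definition G2_structures :: "'m chart set \<Rightarrow> 'm dform set \<Rightarrow> 'm dform set" where
  "G2_structures A cl = {\<phi>\<in>cl. \<forall>c\<in>A. \<forall>x\<in>chart_img c. positive_3form (\<phi> c x)}"

definition dform_star :: "'m dform \<Rightarrow> nat \<Rightarrow> 'm dform \<Rightarrow> 'm dform" where
  "dform_star \<phi> k \<omega> c x = hodge_star (G2_metric (\<phi> c x)) k (\<omega> c x)"

text \<open>\<open>\<delta> = (-1)\<^sup>k * d *\<close> on \<open>k\<close>-forms, \<open>k \<le> 7\<close>\<close>

definition codifferential :: "'m dform \<Rightarrow> nat \<Rightarrow> 'm dform \<Rightarrow> 'm dform" where
  "codifferential \<phi> k \<omega> c x v =
     (-1)^k * dform_star \<phi> (8 - k) (ext_deriv (7 - k) (dform_star \<phi> k \<omega>)) c x v"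

definition torsion_free :: "'m chart set \<Rightarrow> 'm dform \<Rightarrow> bool" where
  "torsion_free A \<phi> \<longleftrightarrow>
     dform_eq A (ext_deriv 3 \<phi>) (\<lambda>_ _ _. 0) \<and> dform_eq A (codifferential \<phi> 3 \<phi>) (\<lambda>_ _ _. 0)"

definition dirichlet_energy :: "'m::topological_space chart set \<Rightarrow> 'm dform \<Rightarrow> real" where
  "dirichlet_energy A \<phi> = dform_integral A
     (\<lambda>c x v. form_inner (G2_metric (\<phi> c x)) 2 (codifferential \<phi> 3 \<phi> c x) (codifferential \<phi> 3 \<phi> c x)
        * dform_star \<phi> 0 (\<lambda>_ _ _. 1) c x v)"

text \<open>Smoothness of a path of forms is joint smoothness in time and position.\<close>

definition smooth_path_on ::
  "'m chart set \<Rightarrow> real set \<Rightarrow> (real \<Rightarrow> 'm dform) \<Rightarrow> bool" where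
  "smooth_path_on A I \<phi> \<longleftrightarrow>
     (\<forall>c\<in>A. \<forall>v. smooth_on (I \<times> chart_img c) (\<lambda>(t, x). \<phi> t c x v))"

end

theory Submission
  imports Defs
begin

text \<open>The Dirichlet energy is non-negative and vanishes at torsion free structures, so \<open>t = 0\<close> is a
  minimum of \<open>t \<mapsto> \<E>(\<phi>(t))\<close> and the second derivative there is non-negative as soon as it exists.
  The work lies in the existence. The equation \<open>6 g = *Q\<close> reads \<open>sqrt (det g) g = q\<close> with
  \<open>q = Q / 6\<close>, whose only positive definite solution is \<open>g = (det q)\<^bsup>-1/9\<^esup> q\<close>; hence the metric, the
  Hodge star, the codifferential and the energy density are smooth in time and position. Finally,
  a partition of unity reduces the energy to a finite sum of integrals over compact subsets of
  charts, where one may differentiate under the integral sign.\<close>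

section \<open>Smooth functions\<close>

text \<open>Two obstacles shape the route. The metric is a definite description, and nothing about
  it can be differentiated until existence and uniqueness have turned it into a formula. After that,
  everything up to the density is built from the components of the forms by sums, products, position
  derivatives, real powers of positive functions and quotients by positive determinants, so closure
  of smoothness under these operations is the whole task. Secondly, a chart image is an arbitrary
  open set near whose boundary the density may be unbounded, so it has to be cut off before
  differentiating the integral; the cutoff is merely continuous, which is harmless because it does
  not depend on time. Positivity of the 3-forms enters twice: it gives \<open>det q > 0\<close>,
  where the ninth root is smooth, and it makes the metric positive definite, hence the density
  non-negative.\<close>

lemma C_on_cong:
  assumes "open S" "C_on n S f" "\<And>x. x \<in> S \<Longrightarrow> f x = g x"
  shows "C_on n S g"
  using assms(2,3)
proof (induction n arbitrary: f g)
  case 0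
  then show ?case by (metis C_on.simps(1) continuous_on_cong)
next
  case (Suc n)
  have d: "(g has_derivative frechet_derivative f (at x)) (at x)" if "x \<in> S" for x
    using Suc.prems that has_derivative_transform_within_open[OF _ assms(1) that]
    by (metis C_on.simps(2) frechet_derivative_works)
  have e: "frechet_derivative f (at x) = frechet_derivative g (at x)" if "x \<in> S" for x
    using d[OF that] frechet_derivative_at by blast
  have "C_on n S (\<lambda>x. frechet_derivative g (at x) v)" for v
    by (rule Suc.IH[of "\<lambda>x. frechet_derivative f (at x) v"]) (use Suc.prems e in auto)
  with d show ?case by (auto simp: differentiable_def)
qed

text \<open>\<open>C_on\<close> speaks of \<open>frechet_derivative\<close>, a choice operator.
  Uniqueness of the two-sided derivative allows an explicit formula \<open>D\<close> in its place,
  so that the closure lemmas can recurse on the product and power rules.\<close>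

lemma C_on_SucI:
  assumes "open S" "\<And>x. x \<in> S \<Longrightarrow> (f has_derivative D x) (at x)" "\<And>v. C_on n S (\<lambda>x. D x v)"
  shows "C_on (Suc n) S f"
proof -
  have "D x = frechet_derivative f (at x)" if "x \<in> S" for x
    using assms(2)[OF that] frechet_derivative_at by blast
  then have "C_on n S (\<lambda>x. frechet_derivative f (at x) v)" for v
    by (intro C_on_cong[OF assms(1) assms(3)[of v]]) auto
  with assms(2) show ?thesis by (auto simp: differentiable_def)
qed

lemma C_on_Suc_has_derivative:
  "C_on (Suc n) S f \<Longrightarrow> x \<in> S \<Longrightarrow> (f has_derivative frechet_derivative f (at x)) (at x)"
  using frechet_derivative_works by auto

lemma C_on_Suc_imp_C_on: "C_on (Suc n) S f \<Longrightarrow> C_on n S f"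
proof (induction n arbitrary: f)
  case 0
  then show ?case
    by (auto intro!: differentiable_imp_continuous_on
        simp: differentiable_on_def differentiable_at_withinI)
next
  case (Suc n)
  then show ?case by (metis C_on.simps(2))
qed

lemma C_on_const: "open S \<Longrightarrow> C_on n S (\<lambda>x. c)"
proof (induction n arbitrary: c)
  case (Suc n)
  then show ?case by (intro C_on_SucI[where D="\<lambda>_ _. 0"]) auto
qed auto

lemma C_on_add:
  assumes "open S"
  shows "C_on n S f \<Longrightarrow> C_on n S g \<Longrightarrow> C_on n S (\<lambda>x. f x + g x)"
proof (induction n arbitrary: f g)
  case (Suc n)
  show ?case
    by (rule C_on_SucI[OF assms has_derivative_add[OF C_on_Suc_has_derivative[OF Suc.prems(1)]
        C_on_Suc_has_derivative[OF Suc.prems(2)]]]) (use Suc in auto)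
qed (auto intro: continuous_intros)

text \<open>The product rule pairs the derivative of one factor with the other factor itself, so the
  undifferentiated factors must be available at order \<open>n\<close> too; this is what
  \<open>C_on_Suc_imp_C_on\<close> supplies.\<close>

lemma C_on_mult:
  fixes f g :: "'a::real_normed_vector \<Rightarrow> real"
  assumes "open S"
  shows "C_on n S f \<Longrightarrow> C_on n S g \<Longrightarrow> C_on n S (\<lambda>x. f x * g x)"
proof (induction n arbitrary: f g)
  case (Suc n)
  note fg = Suc.prems[THEN C_on_Suc_imp_C_on]
  show ?case
    by (rule C_on_SucI[OF assms has_derivative_mult[OF C_on_Suc_has_derivative[OF Suc.prems(1)]
        C_on_Suc_has_derivative[OF Suc.prems(2)]]])
      (use Suc.prems fg in \<open>auto intro!: C_on_add[OF assms] Suc.IH\<close>)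
qed (auto intro: continuous_intros)

text \<open>Differentiation lowers the exponent by one, hence the induction over all real exponents.
  Reciprocals, square roots and the ninth root in the metric are instances.\<close>

lemma C_on_powr:
  fixes f :: "'a::real_normed_vector \<Rightarrow> real"
  assumes "open S" and pos: "\<And>x. x \<in> S \<Longrightarrow> f x > 0"
  shows "C_on n S f \<Longrightarrow> C_on n S (\<lambda>x. f x powr a)"
proof (induction n arbitrary: a)
  case 0
  with pos show ?case by (fastforce intro!: continuous_intros)
next
  case (Suc n)
  have D: "((\<lambda>x. f x powr a) has_derivative
      (\<lambda>v. frechet_derivative f (at x) v * (a * f x powr (a - 1)))) (at x)" if "x \<in> S" for x
    by (rule DERIV_compose_FDERIV[OF has_real_derivative_powr[OF pos[OF that]]
        C_on_Suc_has_derivative[OF Suc.prems that]])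
  show ?case
  proof (rule C_on_SucI[OF assms(1) D])
    show "C_on n S (\<lambda>x. frechet_derivative f (at x) v * (a * f x powr (a - 1)))" for v
      using Suc.prems Suc.IH[OF C_on_Suc_imp_C_on[OF Suc.prems]]
      by (intro C_on_mult[OF assms(1)] C_on_const[OF assms(1)]) auto
  qed
qed

lemma smooth_on_cong:
  "open S \<Longrightarrow> smooth_on S f \<Longrightarrow> (\<And>x. x \<in> S \<Longrightarrow> f x = g x) \<Longrightarrow> smooth_on S g"
  unfolding smooth_on_def using C_on_cong by blast

lemma smooth_on_const: "open S \<Longrightarrow> smooth_on S (\<lambda>x. c)"
  unfolding smooth_on_def using C_on_const by blast

lemma smooth_on_add:
  "open S \<Longrightarrow> smooth_on S f \<Longrightarrow> smooth_on S g \<Longrightarrow> smooth_on S (\<lambda>x. f x + g x)"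
  unfolding smooth_on_def using C_on_add by blast

lemma smooth_on_mult:
  fixes f g :: "'a::real_normed_vector \<Rightarrow> real"
  shows "open S \<Longrightarrow> smooth_on S f \<Longrightarrow> smooth_on S g \<Longrightarrow> smooth_on S (\<lambda>x. f x * g x)"
  unfolding smooth_on_def using C_on_mult by blast

lemma smooth_on_powr:
  fixes f :: "'a::real_normed_vector \<Rightarrow> real"
  shows "open S \<Longrightarrow> smooth_on S f \<Longrightarrow> (\<And>x. x \<in> S \<Longrightarrow> f x > 0) \<Longrightarrow> smooth_on S (\<lambda>x. f x powr a)"
  unfolding smooth_on_def using C_on_powr by blast

lemma smooth_on_divide:
  fixes f g :: "'a::real_normed_vector \<Rightarrow> real"
  assumes "open S" "smooth_on S f" "smooth_on S g" and pos: "\<And>x. x \<in> S \<Longrightarrow> g x > 0"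
  shows "smooth_on S (\<lambda>x. f x / g x)"
proof (rule smooth_on_cong[OF assms(1)])
  show "smooth_on S (\<lambda>x. f x * g x powr (-1))"
    by (intro smooth_on_mult smooth_on_powr assms)
  show "f x * g x powr (-1) = f x / g x" if "x \<in> S" for x
    using pos[OF that] by (simp add: powr_minus divide_inverse)
qed

lemma smooth_on_divide_const:
  fixes f :: "'a::real_normed_vector \<Rightarrow> real"
  shows "open S \<Longrightarrow> smooth_on S f \<Longrightarrow> smooth_on S (\<lambda>x. f x / c)"
  unfolding divide_inverse by (intro smooth_on_mult smooth_on_const)

lemma smooth_on_sqrt:
  fixes f :: "'a::real_normed_vector \<Rightarrow> real"
  assumes "open S" "smooth_on S f" and pos: "\<And>x. x \<in> S \<Longrightarrow> f x > 0"
  shows "smooth_on S (\<lambda>x. sqrt (f x))"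
proof (rule smooth_on_cong[OF assms(1)])
  show "smooth_on S (\<lambda>x. f x powr (1/2))"
    by (intro smooth_on_powr assms)
  show "f x powr (1/2) = sqrt (f x)" if "x \<in> S" for x
    using pos[OF that] by (simp add: powr_half_sqrt)
qed

lemma smooth_on_sum:
  assumes "open S" "\<And>i. i \<in> I \<Longrightarrow> smooth_on S (f i)"
  shows "smooth_on S (\<lambda>x. \<Sum>i\<in>I. f i x)"
  using assms(2)
  by (induction I rule: infinite_finite_induct)
    (auto intro: smooth_on_add smooth_on_const assms(1))

lemma smooth_on_prod:
  fixes f :: "'i \<Rightarrow> 'a::real_normed_vector \<Rightarrow> real"
  assumes "open S" "\<And>i. i \<in> I \<Longrightarrow> smooth_on S (f i)"
  shows "smooth_on S (\<lambda>x. \<Prod>i\<in>I. f i x)"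
  using assms(2)
  by (induction I rule: infinite_finite_induct)
    (auto intro: smooth_on_mult smooth_on_const assms(1))

lemma smooth_on_has_derivative:
  "smooth_on S f \<Longrightarrow> x \<in> S \<Longrightarrow> (f has_derivative frechet_derivative f (at x)) (at x)"
  using C_on_Suc_has_derivative[of 0] unfolding smooth_on_def by blast

lemma smooth_on_frechet_derivative:
  "smooth_on S f \<Longrightarrow> smooth_on S (\<lambda>x. frechet_derivative f (at x) v)"
  unfolding smooth_on_def by (metis C_on.simps(2))

lemma smooth_on_imp_continuous_on: "smooth_on S f \<Longrightarrow> continuous_on S f"
  unfolding smooth_on_def by (metis C_on.simps(1))

section \<open>Partial derivatives in time and position\<close>

lemma smooth_on_snd_has_derivative:
  assumes "smooth_on (I \<times> U) (\<lambda>(t, x). F t x)" "t \<in> I" "x \<in> U"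
  shows "(F t has_derivative (\<lambda>w. frechet_derivative (\<lambda>(t, x). F t x) (at (t, x)) (0, w))) (at x)"
proof -
  have "((\<lambda>y. (\<lambda>(t, x). F t x) (t, y)) has_derivative
      (\<lambda>w. frechet_derivative (\<lambda>(t, x). F t x) (at (t, x)) (0, w))) (at x)"
    by (rule has_derivative_compose[where g="\<lambda>(t, x). F t x" and f="\<lambda>y. (t, y)"])
      (use assms in \<open>auto intro!: derivative_eq_intros smooth_on_has_derivative\<close>)
  then show ?thesis by simp
qed

lemma smooth_on_fst_has_derivative:
  assumes "smooth_on (I \<times> U) (\<lambda>(t, x). F t x)" "t \<in> I" "x \<in> U"
  shows "((\<lambda>s. F s x) has_derivative (\<lambda>w. frechet_derivative (\<lambda>(t, x). F t x) (at (t, x)) (w, 0))) (at t)"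
proof -
  have "((\<lambda>y. (\<lambda>(t, x). F t x) (y, x)) has_derivative
      (\<lambda>w. frechet_derivative (\<lambda>(t, x). F t x) (at (t, x)) (w, 0))) (at t)"
    by (rule has_derivative_compose[where g="\<lambda>(t, x). F t x" and f="\<lambda>y. (y, x)"])
      (use assms in \<open>auto intro!: derivative_eq_intros smooth_on_has_derivative\<close>)
  then show ?thesis by simp
qed

text \<open>\<open>ext_deriv\<close> differentiates in position with time frozen. Joint smoothness
  survives because this partial derivative is the total derivative in the direction
  \<open>(0, w)\<close>.\<close>

lemma smooth_on_partial_snd:
  assumes "open I" "open U" "smooth_on (I \<times> U) (\<lambda>(t, x). F t x)"
  shows "smooth_on (I \<times> U) (\<lambda>(t, x). frechet_derivative (F t) (at x) w)"
proof (rule smooth_on_cong[OF _ smooth_on_frechet_derivative[OF assms(3)]])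
  show "open (I \<times> U)" using assms by (simp add: open_Times)
next
  fix z assume "z \<in> I \<times> U"
  then show "frechet_derivative (\<lambda>(t, x). F t x) (at z) (0, w) =
      (case z of (t, x) \<Rightarrow> frechet_derivative (F t) (at x) w)"
    using frechet_derivative_at[OF smooth_on_snd_has_derivative[OF assms(3)]] by (auto dest: fun_cong)
qed

section \<open>Integrals depending on a parameter\<close>

lemma continuous_on_Times_extend_zero:
  fixes f :: "real \<Rightarrow> vec7 \<Rightarrow> real"
  assumes "open I" "open U" "closed K" "K \<subseteq> U"
    and f: "continuous_on (I \<times> U) (\<lambda>(t, x). f t x)"
    and r: "continuous_on U r" "\<And>x. x \<in> U \<Longrightarrow> x \<notin> K \<Longrightarrow> r x = 0"
  shows "continuous_on (I \<times> V) (\<lambda>(t, x). if x \<in> U then r x * f t x else (0::real))"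
proof -
  \<comment> \<open>On the first open set the function is the product, on the second it is zero;
    since \<open>K\<close> lies in \<open>U\<close>, together they cover
    \<open>I \<times> UNIV\<close>.\<close>
  have "continuous_on ((I \<times> U) \<union> (I \<times> - K)) (\<lambda>(t, x). if x \<in> U then r x * f t x else 0)"
  proof (rule continuous_on_open_Un)
    have "continuous_on (I \<times> U) (\<lambda>z. r (snd z) * (case z of (t, x) \<Rightarrow> f t x))"
      by (intro continuous_intros f continuous_on_compose2[OF r(1)]) auto
    then show "continuous_on (I \<times> U) (\<lambda>(t, x). if x \<in> U then r x * f t x else 0)"
      by (rule continuous_on_eq) auto
    show "continuous_on (I \<times> - K) (\<lambda>(t, x). if x \<in> U then r x * f t x else 0)"
      by (rule continuous_on_eq[of _ "\<lambda>_. 0"]) (auto simp: r(2))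
  qed (use assms in \<open>auto intro: open_Times\<close>)
  then show ?thesis by (rule continuous_on_subset) (use assms(4) in auto)
qed

text \<open>The Leibniz rule is applied over a compact box, whereas \<open>U\<close> is any open
  set. As \<open>r\<close> vanishes off the compact set \<open>K\<close>, extension by zero turns
  the integral over \<open>U\<close> into one over a box around \<open>K\<close>, with an integrand
  that stays jointly continuous.\<close>

lemma DERIV_integral_smooth:
  fixes f :: "real \<Rightarrow> vec7 \<Rightarrow> real"
  assumes "open U" "compact K" "K \<subseteq> U"
    and f: "smooth_on ({a<..<b} \<times> U) (\<lambda>(t, x). f t x)"
    and r: "continuous_on U r" "\<And>x. x \<in> U \<Longrightarrow> x \<notin> K \<Longrightarrow> r x = 0"
    and t: "t \<in> {a<..<b}"
  shows "((\<lambda>s. integral U (\<lambda>x. r x * f s x)) has_real_derivative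
      integral U (\<lambda>x. r x * frechet_derivative (\<lambda>(t, x). f t x) (at (t, x)) (1, 0))) (at t)"
proof -
  let ?I = "{a<..<b}"
  define D where "D s x = frechet_derivative (\<lambda>(t, x). f t x) (at (s, x)) (1, 0)" for s x
  obtain l u where lu: "K \<subseteq> cbox l u"
    using bounded_subset_cbox_symmetric[OF compact_imp_bounded[OF assms(2)]] by blast
  define ext where "ext g x = (if x \<in> U then r x * g x else 0)" for g :: "vec7 \<Rightarrow> real" and x
  have int_eq: "integral U (\<lambda>x. r x * g x) = integral (cbox l u) (ext g)" for g
  proof -
    have "integral U (\<lambda>x. r x * g x) = integral UNIV (ext g)"
      unfolding ext_def by (rule integral_restrict_UNIV[symmetric])
    also have "\<dots> = integral UNIV (\<lambda>x. if x \<in> cbox l u then ext g x else 0)"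
      by (rule integral_cong) (use lu r(2) in \<open>auto simp: ext_def\<close>)
    also have "\<dots> = integral (cbox l u) (ext g)" by (rule integral_restrict_UNIV)
    finally show ?thesis .
  qed
  have Df: "((\<lambda>s. f s x) has_real_derivative D s x) (at s)" if "s \<in> ?I" "x \<in> U" for s x
  proof -
    let ?L = "\<lambda>w. frechet_derivative (\<lambda>(t, x). f t x) (at (s, x)) (w, 0)"
    have h: "((\<lambda>s. f s x) has_derivative ?L) (at s)"
      by (rule smooth_on_fst_has_derivative[OF f that])
    \<comment> \<open>A linear map on the real line is multiplication by its value at 1.\<close>
    have "?L = (*) (D s x)"
    proof
      fix w show "?L w = D s x * w"
        using linear_cmul[OF has_derivative_linear[OF h], of w 1] by (simp add: D_def)
    qed
    with h show ?thesis by (simp add: has_field_derivative_def)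
  qed
  have cD: "continuous_on (?I \<times> U) (\<lambda>(t, x). D t x)"
    using smooth_on_imp_continuous_on[OF smooth_on_frechet_derivative[OF f]]
    unfolding D_def case_prod_unfold by simp
  have cont: "continuous_on (?I \<times> cbox l u) (\<lambda>(t, x). ext (g t) x)"
    if "continuous_on (?I \<times> U) (\<lambda>(t, x). g t x)" for g
    unfolding ext_def
    by (rule continuous_on_Times_extend_zero)
      (use assms(1-3) r that in \<open>auto intro: compact_imp_closed\<close>)
  have "((\<lambda>s. integral (cbox l u) (ext (f s))) has_real_derivative integral (cbox l u) (ext (D t)))
      (at t within ?I)"
  proof (rule leibniz_rule_field_derivative)
    show "((\<lambda>s. ext (f s) x) has_real_derivative ext (D s) x) (at s within ?I)" if "s \<in> ?I" for s x
      using that by (cases "x \<in> U")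
        (auto simp: ext_def intro!: DERIV_cmult has_field_derivative_at_within[OF Df])
    show "ext (f s) integrable_on cbox l u" if "s \<in> ?I" for s
    proof (rule integrable_continuous)
      have "continuous_on (cbox l u) (\<lambda>x. (s, x))" by (intro continuous_intros)
      moreover have "(\<lambda>x. (s, x)) ` cbox l u \<subseteq> {a<..<b} \<times> cbox l u" using that by auto
      ultimately show "continuous_on (cbox l u) (ext (f s))"
        using continuous_on_compose2[OF cont[OF smooth_on_imp_continuous_on[OF f]]] by fastforce
    qed
  qed (use cont[OF cD] t in auto)
  then show ?thesis
    using t by (simp add: int_eq D_def[symmetric] at_within_open[of t ?I])
qed

text \<open>If \<open>D < 0\<close>, then \<open>f'\<close>, which vanishes at the minimum, is
  negative just to the right of \<open>a\<close>, and the mean value theorem puts \<open>f\<close>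
  below its minimum there.\<close>

lemma second_deriv_nonneg_at_min:
  fixes f f' :: "real \<Rightarrow> real"
  assumes "\<epsilon> > 0" and f': "\<And>t. \<bar>t - a\<bar> < \<epsilon> \<Longrightarrow> (f has_real_derivative f' t) (at t)"
    and f'': "(f' has_real_derivative D) (at a)"
    and min: "\<And>t. \<bar>t - a\<bar> < \<epsilon> \<Longrightarrow> f a \<le> f t"
  shows "D \<ge> 0"
proof (rule ccontr)
  assume "\<not> D \<ge> 0"
  then obtain d where d: "d > 0" "\<And>h. h > 0 \<Longrightarrow> h < d \<Longrightarrow> f' (a + h) < f' a"
    using DERIV_neg_dec_right[OF f''] by fastforce
  have "f' a = 0"
    by (rule DERIV_local_min[OF f'[of a] \<open>\<epsilon> > 0\<close>]) (use min \<open>\<epsilon> > 0\<close> in \<open>auto simp: abs_minus_commute\<close>)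
  define h where "h = min d \<epsilon> / 2"
  have h: "h > 0" "h < d" "h < \<epsilon>" using d(1) \<open>\<epsilon> > 0\<close> by (auto simp: h_def)
  have "\<exists>z>a. z < a + h \<and> f (a + h) - f a = (a + h - a) * f' z"
    using h by (intro MVT2) (auto intro!: f')
  then obtain z where z: "a < z" "z < a + h" "f (a + h) - f a = h * f' z" by auto
  have "f' z < 0" using d(2)[of "z - a"] z(1,2) h \<open>f' a = 0\<close> by simp
  then have "f (a + h) < f a" using z(3) h(1) by (smt (verit) mult_pos_neg)
  with min[of "a + h"] h show False by simp
qed

section \<open>Inner products\<close>

text \<open>Semidefiniteness passes to the Schur complement, which drives the induction on the index
  set. The price is that a pivot may vanish, in which case its whole row vanishes too. The factor
  later yields positive determinants and sums of squares.\<close>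

lemma psd_gram_factor:
  fixes H :: "'i \<Rightarrow> 'i \<Rightarrow> real"
  assumes "finite I" "\<And>i j. H i j = H j i" "\<And>v. (\<Sum>i\<in>I. \<Sum>j\<in>I. v i * H i j * v j) \<ge> 0"
  shows "\<exists>B. \<forall>i\<in>I. \<forall>j\<in>I. H i j = (\<Sum>k\<in>I. B k i * B k j)"
  using assms
proof (induction I arbitrary: H)
  case (insert x I)
  define Hx where "Hx = H x x"
  have split: "(\<Sum>i\<in>insert x I. \<Sum>j\<in>insert x I. v i * H i j * v j) =
      (\<Sum>i\<in>I. \<Sum>j\<in>I. v i * H i j * v j) + 2 * v x * (\<Sum>i\<in>I. H x i * v i) + Hx * (v x)\<^sup>2" for v
  proof -
    have 1: "(\<Sum>j\<in>I. v x * H x j * v j) = v x * (\<Sum>i\<in>I. H x i * v i)"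
      by (simp add: sum_distrib_left mult.assoc)
    have 2: "(\<Sum>i\<in>I. v i * H i x * v x) = v x * (\<Sum>i\<in>I. H x i * v i)"
      by (simp add: sum_distrib_left insert.prems(1)[of _ x] mult_ac)
    have "(\<Sum>i\<in>insert x I. \<Sum>j\<in>insert x I. v i * H i j * v j) =
        v x * H x x * v x + (\<Sum>j\<in>I. v x * H x j * v j) +
        ((\<Sum>i\<in>I. v i * H i x * v x) + (\<Sum>i\<in>I. \<Sum>j\<in>I. v i * H i j * v j))"
      using insert.hyps by (simp add: sum.distrib)
    then show ?thesis unfolding 1 2 Hx_def power2_eq_square by (simp add: algebra_simps)
  qed
  have Hx: "Hx \<ge> 0"
  proof -
    let ?v = "\<lambda>i. if i = x then 1 else 0 :: real"
    have v: "?v i = 0" if "i \<in> I" for i using that insert.hyps by auto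
    have "(\<Sum>i\<in>I. \<Sum>j\<in>I. ?v i * H i j * ?v j) = 0" "(\<Sum>i\<in>I. H x i * ?v i) = 0"
      by (simp_all only: v mult_zero_left mult_zero_right sum.neutral_const cong: sum.cong)
    then show ?thesis using insert.prems(2)[of ?v] unfolding split by simp
  qed
  have zero: "H x i = 0" if "Hx = 0" "i \<in> I" for i
  proof (rule ccontr)
    assume n: "H x i \<noteq> 0"
    \<comment> \<open>Chosen so that, with a vanishing pivot, the quadratic form takes the value -1
      at \<open>s\<close> times the basis vector of \<open>x\<close> plus that of
      \<open>i\<close>.\<close>
    define s where "s = - (H i i + 1) / (2 * H x i)"
    define v where "v j = (if j = x then s else if j = i then 1 else 0)" for j
    have ix: "i \<noteq> x" using insert.hyps that by auto
    have "(\<Sum>k\<in>I. \<Sum>j\<in>I. v k * H k j * v j) = (\<Sum>k\<in>I. \<Sum>j\<in>I. if k = i \<and> j = i then H i i else 0)"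
      by (intro sum.cong refl) (use insert.hyps in \<open>auto simp: v_def\<close>)
    also have "\<dots> = (\<Sum>k\<in>I. if k = i then H i i else 0)"
      by (intro sum.cong refl) (use insert.hyps that in auto)
    also have "\<dots> = H i i" using insert.hyps that by simp
    finally have 1: "(\<Sum>k\<in>I. \<Sum>j\<in>I. v k * H k j * v j) = H i i" .
    have "(\<Sum>k\<in>I. H x k * v k) = (\<Sum>k\<in>I. if k = i then H x i else 0)"
      by (intro sum.cong refl) (use insert.hyps in \<open>auto simp: v_def\<close>)
    also have "\<dots> = H x i" using insert.hyps that by simp
    finally have 2: "(\<Sum>k\<in>I. H x k * v k) = H x i" .
    have "H i i + 2 * s * H x i \<ge> 0"
      using insert.prems(2)[of v] that unfolding split 1 2 by (simp add: v_def)
    moreover have "2 * s * H x i = - (H i i + 1)" using n by (simp add: s_def)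
    ultimately show False by simp
  qed
  \<comment> \<open>Cholesky elimination of the index \<open>x\<close>: \<open>H'\<close> is the Schur complement\<close>
  define H' where "H' i j = H i j - H x i * H x j / Hx" for i j
  have "\<exists>B. \<forall>i\<in>I. \<forall>j\<in>I. H' i j = (\<Sum>k\<in>I. B k i * B k j)"
  proof (rule insert.IH)
    show "H' i j = H' j i" for i j
      using insert.prems(1)[of i j] by (simp add: H'_def)
    show "(\<Sum>i\<in>I. \<Sum>j\<in>I. v i * H' i j * v j) \<ge> 0" for v
    proof -
      define S where "S = (\<Sum>i\<in>I. H x i * v i)"
      \<comment> \<open>The coordinate at \<open>x\<close> that minimises the quadratic form for
        given \<open>v\<close> on \<open>I\<close>; if \<open>Hx = 0\<close>, division by zero makes
        it 0.\<close>
      define w where "w = v(x := - S / Hx)"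
      have wv: "w i = v i" if "i \<in> I" for i using that insert.hyps by (auto simp: w_def)
      have "(\<Sum>i\<in>I. \<Sum>j\<in>I. v i * H' i j * v j) =
          (\<Sum>i\<in>I. \<Sum>j\<in>I. v i * H i j * v j) - (\<Sum>i\<in>I. \<Sum>j\<in>I. (H x i * v i) * (H x j * v j)) / Hx"
        by (simp add: H'_def algebra_simps sum_subtractf sum_divide_distrib)
      also have "(\<Sum>i\<in>I. \<Sum>j\<in>I. (H x i * v i) * (H x j * v j)) = S * S"
        by (simp add: S_def sum_product)
      finally have e: "(\<Sum>i\<in>I. \<Sum>j\<in>I. v i * H' i j * v j) = (\<Sum>i\<in>I. \<Sum>j\<in>I. v i * H i j * v j) - S * S / Hx" .
      have "0 \<le> (\<Sum>i\<in>I. \<Sum>j\<in>I. v i * H i j * v j) + 2 * w x * S + Hx * (w x)\<^sup>2"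
        using insert.prems(2)[of w] unfolding split by (simp add: wv S_def)
      moreover have "2 * w x * S + Hx * (w x)\<^sup>2 = - (S * S / Hx)"
        by (cases "Hx = 0") (auto simp: w_def power2_eq_square field_simps)
      ultimately show ?thesis unfolding e by simp
    qed
  qed
  then obtain B where B: "\<And>i j. i \<in> I \<Longrightarrow> j \<in> I \<Longrightarrow> H' i j = (\<Sum>k\<in>I. B k i * B k j)" by blast
  \<comment> \<open>The eliminated index contributes a new row, and the old rows get a zero in
    column \<open>x\<close>. If \<open>Hx = 0\<close>, the new row is 0 by division by zero, in
    agreement with \<open>zero\<close>.\<close>
  define C where "C k i = (if k = x then H x i / sqrt Hx else if i = x then 0 else B k i)" for k i
  have sum_C: "(\<Sum>k\<in>insert x I. C k i * C k j) = H x i * H x j / Hx +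
      (if i = x \<or> j = x then 0 else \<Sum>k\<in>I. B k i * B k j)" for i j
  proof -
    have "(\<Sum>k\<in>insert x I. C k i * C k j) = C x i * C x j + (\<Sum>k\<in>I. C k i * C k j)"
      using insert.hyps by simp
    also have "(\<Sum>k\<in>I. C k i * C k j) = (\<Sum>k\<in>I. if i = x \<or> j = x then 0 else B k i * B k j)"
      by (intro sum.cong refl) (use insert.hyps in \<open>auto simp: C_def\<close>)
    also have "\<dots> = (if i = x \<or> j = x then 0 else \<Sum>k\<in>I. B k i * B k j)" by simp
    also have "C x i * C x j = H x i * H x j / Hx" using Hx by (simp add: C_def)
    finally show ?thesis .
  qed
  have "H i j = (\<Sum>k\<in>insert x I. C k i * C k j)" if ij: "i \<in> insert x I" "j \<in> insert x I" for i j
  proof (cases "i = x \<or> j = x")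
    case True
    then show ?thesis
      using zero ij insert.prems(1)[of i x] unfolding sum_C by (cases "Hx = 0") (auto simp: Hx_def)
  next
    case False
    then show ?thesis using B[of i j] ij unfolding sum_C by (auto simp: H'_def)
  qed
  then show ?case by blast
qed auto

lemma inner_product_matrix_factor:
  assumes "inner_product_matrix G"
  obtains B :: "real^7^7" where "transpose B ** B = G"
proof -
  have "\<exists>B :: 7 \<Rightarrow> 7 \<Rightarrow> real. \<forall>i\<in>UNIV. \<forall>j\<in>UNIV. G $ i $ j = (\<Sum>k\<in>UNIV. B k i * B k j)"
  proof (rule psd_gram_factor[of UNIV "\<lambda>i j. G $ i $ j"])
    have "transpose G = G" using assms by (simp add: inner_product_matrix_def)
    then show "G $ i $ j = G $ j $ i" for i j by (auto simp: transpose_def vec_eq_iff)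
    show "0 \<le> (\<Sum>i\<in>UNIV. \<Sum>j\<in>UNIV. v i * G $ i $ j * v j)" for v
    proof -
      have "(\<Sum>i\<in>UNIV. \<Sum>j\<in>UNIV. v i * G $ i $ j * v j) = (\<chi> i. v i) \<bullet> (G *v (\<chi> i. v i))"
        by (simp add: inner_vec_def matrix_vector_mult_def sum_distrib_left mult.assoc)
      then show ?thesis using assms
        by (cases "(\<chi> i. v i) = 0") (auto simp: inner_product_matrix_def less_imp_le)
    qed
  qed simp
  then obtain B :: "7 \<Rightarrow> 7 \<Rightarrow> real" where "\<And>i j. G $ i $ j = (\<Sum>k\<in>UNIV. B k i * B k j)" by blast
  then have "transpose (\<chi> k i. B k i) ** (\<chi> k i. B k i) = G"
    by (simp add: vec_eq_iff matrix_matrix_mult_def transpose_def)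
  then show ?thesis by (rule that)
qed

lemma inner_product_matrix_invertible:
  assumes "inner_product_matrix G"
  shows "invertible G"
  unfolding invertible_left_inverse matrix_left_invertible_ker
  using assms by (metis inner_product_matrix_def inner_zero_right less_irrefl)

text \<open>The factor \<open>B\<close> makes the determinant a square, and invertibility makes it
  nonzero.\<close>

lemma inner_product_matrix_det_pos:
  assumes "inner_product_matrix G"
  shows "det G > 0"
proof -
  obtain B :: "real^7^7" where "transpose B ** B = G"
    by (rule inner_product_matrix_factor[OF assms])
  then have "det G = det B * det B" by (metis det_mul det_transpose)
  moreover have "det G \<noteq> 0"
    using inner_product_matrix_invertible[OF assms] by (simp add: invertible_det_nz)
  ultimately show ?thesis by (auto simp: less_le)
qed

lemma
  fixes A :: "'a::semiring_1^'n^'m"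
  assumes "invertible A"
  shows matrix_inv_right: "A ** matrix_inv A = mat 1"
    and matrix_inv_left: "matrix_inv A ** A = mat 1"
  using someI_ex[OF assms[unfolded invertible_def]] by (auto simp: matrix_inv_def)

lemma det_matrix_inv:
  fixes G :: "real^'n^'n"
  assumes "invertible G"
  shows "det (matrix_inv G) = 1 / det G"
proof -
  have "det G * det (matrix_inv G) = 1"
    using matrix_inv_right[OF assms] by (metis det_I det_mul)
  then show ?thesis using assms by (simp add: invertible_det_nz field_simps)
qed

text \<open>If \<open>G = transpose B ** B\<close>, the columns of the inverse of \<open>B\<close>
  form an orthonormal frame. \<open>C k\<close> is its \<open>k\<close>-th vector, and the inverse
  metric is the sum of the squares of these vectors.\<close>

lemma inner_product_matrix_inv_factor:
  assumes "inner_product_matrix G"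
  obtains C :: "7 \<Rightarrow> 7 \<Rightarrow> real" where "\<And>i j. matrix_inv G $ i $ j = (\<Sum>k\<in>UNIV. C k i * C k j)"
proof -
  obtain B :: "real^7^7" where B: "transpose B ** B = G"
    by (rule inner_product_matrix_factor[OF assms])
  have G: "invertible G" by (rule inner_product_matrix_invertible[OF assms])
  have "invertible B"
    using G B by (metis det_mul invertible_det_nz mult_zero_right)
  then have i: "matrix_inv B ** B = mat 1" "B ** matrix_inv B = mat 1"
    by (simp_all add: matrix_inv_left matrix_inv_right)
  have "(matrix_inv B ** transpose (matrix_inv B)) ** G =
      matrix_inv B ** transpose (B ** matrix_inv B) ** B"
    unfolding matrix_transpose_mul B[symmetric] by (simp add: matrix_mul_assoc)
  also have "\<dots> = mat 1" using i by (simp add: transpose_mat matrix_mul_rid)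
  finally have "(matrix_inv B ** transpose (matrix_inv B)) ** G = mat 1" .
  then have "matrix_inv G = (matrix_inv B ** transpose (matrix_inv B)) ** (G ** matrix_inv G)"
    by (simp only: matrix_mul_assoc matrix_mul_lid)
  then have "matrix_inv G = matrix_inv B ** transpose (matrix_inv B)"
    by (simp only: matrix_inv_right[OF G] matrix_mul_rid)
  then show ?thesis
    by (intro that[of "\<lambda>k i. matrix_inv B $ i $ k"]) (simp add: matrix_matrix_mult_def transpose_def)
qed

text \<open>With the inverse metric expanded in an orthonormal frame, the product over the slots of
  sums over frame vectors becomes a sum over multi-indices \<open>l\<close>. What remains is a sum
  of squares, those of the frame components when \<open>\<alpha>\<close> is a
  \<open>k\<close>-form.\<close>

lemma form_inner_nonneg:
  assumes "inner_product_matrix G"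
  shows "form_inner G k \<alpha> \<alpha> \<ge> 0"
proof -
  obtain C :: "7 \<Rightarrow> 7 \<Rightarrow> real" where C: "\<And>i j. matrix_inv G $ i $ j = (\<Sum>k\<in>UNIV. C k i * C k j)"
    by (rule inner_product_matrix_inv_factor[OF assms]) (rule that)
  let ?M = "multi_index k" and ?a = "\<lambda>i. \<alpha> (\<lambda>a. axis (i a) 1)"
  have P: "(\<Prod>a<k. matrix_inv G $ i a $ j a) = (\<Sum>l\<in>?M. (\<Prod>a<k. C (l a) (i a)) * (\<Prod>a<k. C (l a) (j a)))" for i j
    unfolding C multi_index_def by (subst prod_sum_PiE) (auto simp: prod.distrib)
  have "(\<Sum>i\<in>?M. \<Sum>j\<in>?M. (\<Prod>a<k. matrix_inv G $ i a $ j a) * ?a i * ?a j) =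
      (\<Sum>i\<in>?M. \<Sum>j\<in>?M. \<Sum>l\<in>?M. ((\<Prod>a<k. C (l a) (i a)) * ?a i) * ((\<Prod>a<k. C (l a) (j a)) * ?a j))"
    unfolding P sum_distrib_right by (simp add: mult_ac)
  also have "\<dots> = (\<Sum>i\<in>?M. \<Sum>l\<in>?M. \<Sum>j\<in>?M. ((\<Prod>a<k. C (l a) (i a)) * ?a i) * ((\<Prod>a<k. C (l a) (j a)) * ?a j))"
    by (intro sum.cong refl sum.swap)
  also have "\<dots> = (\<Sum>l\<in>?M. \<Sum>i\<in>?M. \<Sum>j\<in>?M. ((\<Prod>a<k. C (l a) (i a)) * ?a i) * ((\<Prod>a<k. C (l a) (j a)) * ?a j))"
    by (rule sum.swap)
  also have "\<dots> = (\<Sum>l\<in>?M. (\<Sum>i\<in>?M. (\<Prod>a<k. C (l a) (i a)) * ?a i)\<^sup>2)"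
    by (simp add: power2_eq_square sum_product)
  also have "\<dots> \<ge> 0" by (intro sum_nonneg) simp
  finally show ?thesis unfolding form_inner_def by simp
qed

lemma bij_betw_of_nat_7: "bij_betw (of_nat :: nat \<Rightarrow> 7) {..<7} UNIV"
proof -
  have "{..<7::nat} = {0, 1, 2, 3, 4, 5, 6}" by auto
  then have inj: "inj_on (of_nat :: nat \<Rightarrow> 7) {..<7}"
    by (auto simp: inj_on_def)
  then have "of_nat ` {..<7} = (UNIV :: 7 set)"
    by (intro card_subset_eq) (auto simp: card_image)
  with inj show ?thesis by (auto simp: bij_betw_def)
qed

section \<open>The Hodge star in top degree\<close>

text \<open>Together with \<open>antisym_form\<close>, this determines a 7-form on permuted basis
  vectors by its value on \<open>std_basis\<close>; both properties of a \<open>wedge\<close> follow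
  by looking at its sum over permutations.\<close>

definition depends_upto :: "nat \<Rightarrow> form7 \<Rightarrow> bool" where
  "depends_upto k \<alpha> \<longleftrightarrow> (\<forall>v w. (\<forall>i<k. v i = w i) \<longrightarrow> \<alpha> v = \<alpha> w)"

definition antisym_form :: "nat \<Rightarrow> form7 \<Rightarrow> bool" where
  "antisym_form k \<alpha> \<longleftrightarrow>
     (\<forall>v a b. a < k \<longrightarrow> b < k \<longrightarrow> a \<noteq> b \<longrightarrow> \<alpha> (v \<circ> Transposition.transpose a b) = - \<alpha> v)"

lemma antisym_form_eq_0:
  assumes "antisym_form k \<alpha>" "a < k" "b < k" "a \<noteq> b" "v a = v b"
  shows "\<alpha> v = 0"
proof -
  have "v \<circ> Transposition.transpose a b = v" using assms(5) by (auto simp: fun_eq_iff Transposition.transpose_def)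
  then have "\<alpha> v = - \<alpha> v" using assms(1-4) unfolding antisym_form_def by metis
  then show ?thesis by simp
qed

lemma depends_upto_wedge:
  assumes "depends_upto k \<alpha>" "depends_upto l \<beta>"
  shows "depends_upto (k + l) (wedge k l \<alpha> \<beta>)"
  unfolding depends_upto_def
proof (intro allI impI)
  fix v w :: "nat \<Rightarrow> vec7" assume vw: "\<forall>i<k + l. v i = w i"
  have "\<alpha> (\<lambda>i. v (p i)) = \<alpha> (\<lambda>i. w (p i)) \<and> \<beta> (\<lambda>i. v (p (k + i))) = \<beta> (\<lambda>i. w (p (k + i)))"
    if "p permutes {..<k + l}" for p
  proof -
    have p: "v (p i) = w (p i)" if "i < k + l" for i
      using vw permutes_in_image[OF \<open>p permutes {..<k + l}\<close>, of i] that by auto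
    have "\<alpha> (\<lambda>i. v (p i)) = \<alpha> (\<lambda>i. w (p i))"
      by (intro assms(1)[unfolded depends_upto_def, rule_format] p) simp
    moreover have "\<beta> (\<lambda>i. v (p (k + i))) = \<beta> (\<lambda>i. w (p (k + i)))"
      by (intro assms(2)[unfolded depends_upto_def, rule_format] p) simp
    ultimately show ?thesis ..
  qed
  then show "wedge k l \<alpha> \<beta> v = wedge k l \<alpha> \<beta> w" unfolding wedge_def by simp
qed

text \<open>Composing the summation permutation with a transposition flips every sign, whatever the
  two factors are.\<close>

lemma antisym_form_wedge: "antisym_form (k + l) (wedge k l \<alpha> \<beta>)"
  unfolding antisym_form_def
proof (intro allI impI)
  fix v :: "nat \<Rightarrow> vec7" and a b
  assume ab: "a < k + l" "b < k + l" "a \<noteq> b"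
  let ?\<tau> = "Transposition.transpose a b"
  let ?F = "\<lambda>p. of_int (sign p) * \<alpha> (\<lambda>i. v (p i)) * \<beta> (\<lambda>i. v (p (k + i)))"
  have \<tau>: "?\<tau> permutes {..<k + l}" using ab by (intro permutes_swap_id) auto
  have "(\<Sum>p | p permutes {..<k + l}. ?F p) = (\<Sum>p | p permutes {..<k + l}. ?F (?\<tau> \<circ> p))"
    by (rule setum_permutations_compose_left[OF \<tau>])
  also have "\<dots> = (\<Sum>p | p permutes {..<k + l}. - (of_int (sign p) *
      \<alpha> (\<lambda>i. (v \<circ> ?\<tau>) (p i)) * \<beta> (\<lambda>i. (v \<circ> ?\<tau>) (p (k + i)))))"
  proof (intro sum.cong refl)
    fix p assume "p \<in> {p. p permutes {..<k + l}}"
    then have "sign (?\<tau> \<circ> p) = - sign p"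
      using ab by (subst sign_compose)
        (auto simp: sign_swap_id intro: permutation_swap_id permutes_imp_permutation)
    then show "?F (?\<tau> \<circ> p) = - (of_int (sign p) *
      \<alpha> (\<lambda>i. (v \<circ> ?\<tau>) (p i)) * \<beta> (\<lambda>i. (v \<circ> ?\<tau>) (p (k + i))))" by simp
  qed
  finally show "wedge k l \<alpha> \<beta> (v \<circ> ?\<tau>) = - wedge k l \<alpha> \<beta> v"
    unfolding wedge_def by (simp add: sum_negf)
qed

lemma antisym_form_permutes:
  assumes "p permutes (UNIV :: 7 set)" and \<alpha>: "depends_upto 7 \<alpha>" "antisym_form 7 \<alpha>"
  shows "\<alpha> (\<lambda>a. axis (p (of_nat a)) 1) = of_int (sign p) * \<alpha> std_basis"
  using assms(1) finite[of UNIV]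
proof (induction p rule: permutes_induct)
  case id
  then show ?case by (simp add: std_basis_def[abs_def])
next
  case (swap a b p)
  let ?v = "\<lambda>k. axis (p (of_nat k)) 1 :: vec7"
  have "\<exists>i<7. p (of_nat i) = a" for a
  proof -
    obtain x where "a = p x" using permutes_surj[OF swap.hyps(4)] by (metis surjD)
    moreover obtain i where "i < 7" "x = of_nat i"
      using bij_betw_imp_surj_on[OF bij_betw_of_nat_7] by blast
    ultimately show ?thesis by blast
  qed
  then obtain i j where ij: "i < 7" "p (of_nat i) = a" "j < 7" "p (of_nat j) = b" by metis
  have inj: "p (of_nat k) = p (of_nat l) \<longleftrightarrow> k = l" if "k < 7" "l < 7" for k l
    using permutes_inj[OF swap.hyps(4)] bij_betw_imp_inj_on[OF bij_betw_of_nat_7] that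
    by (metis injD inj_onD lessThan_iff)
  \<comment> \<open>Exchanging the values \<open>a\<close> and \<open>b\<close> of \<open>p\<close>
    amounts to exchanging the slots \<open>i\<close> and \<open>j\<close> where they occur.\<close>
  have "\<alpha> (\<lambda>k. axis ((Transposition.transpose a b \<circ> p) (of_nat k)) 1) = \<alpha> (?v \<circ> Transposition.transpose i j)"
    using \<alpha>(1) unfolding depends_upto_def
  proof (elim allE impE)
    show "\<forall>k<7. axis ((Transposition.transpose a b \<circ> p) (of_nat k)) 1 = (?v \<circ> Transposition.transpose i j) k"
      using ij inj by (auto simp: Transposition.transpose_def)
  qed
  also have "\<dots> = - \<alpha> ?v"
    using \<alpha>(2) ij swap.hyps(3) unfolding antisym_form_def by blast
  also have "\<dots> = - (of_int (sign p) * \<alpha> std_basis)" using swap.IH by simp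
  also have "- sign p = sign (Transposition.transpose a b \<circ> p)"
    using swap.hyps(3,4) by (subst sign_compose)
      (auto simp: sign_swap_id intro: permutation_swap_id permutes_imp_permutation)
  then have "- (of_int (sign p) * \<alpha> std_basis) =
      of_int (sign (Transposition.transpose a b \<circ> p)) * \<alpha> std_basis"
    by (metis minus_mult_left of_int_minus)
  finally show ?case .
qed

text \<open>The permutation \<open>p\<close> as a multi-index; the restriction is there because
  \<open>multi_index\<close> consists of extensional functions.\<close>

definition frame :: "(7 \<Rightarrow> 7) \<Rightarrow> nat \<Rightarrow> 7" where
  "frame p = (\<lambda>a\<in>{..<7}. p (of_nat a))"

lemma frame_image:
  "frame ` {p. p permutes UNIV} = {i \<in> multi_index 7. inj_on i {..<7}}"
proof (intro equalityI subsetI)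
  fix i assume "i \<in> frame ` {p. p permutes UNIV}"
  then obtain p where p: "p permutes UNIV" "i = frame p" by blast
  have "inj_on (p \<circ> of_nat) {..<7}"
    using bij_betw_imp_inj_on[OF bij_betw_of_nat_7] permutes_inj[OF p(1)]
    by (intro comp_inj_on) (auto intro: inj_on_subset)
  then show "i \<in> {i \<in> multi_index 7. inj_on i {..<7}}"
    unfolding p(2) by (auto simp: frame_def multi_index_def inj_on_def)
next
  fix i assume i: "i \<in> {i \<in> multi_index 7. inj_on i {..<7}}"
  define p where "p x = i (inv_into {..<7} of_nat x)" for x :: 7
  have "inj p"
  proof (rule injI)
    fix x y assume "p x = p y"
    then have "inv_into {..<7} of_nat x = inv_into {..<7} (of_nat :: nat \<Rightarrow> 7) y"
      using i bij_betw_apply[OF bij_betw_inv_into[OF bij_betw_of_nat_7]]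
      unfolding p_def inj_on_def by blast
    then show "x = y"
      by (metis UNIV_I bij_betw_inv_into_right bij_betw_of_nat_7)
  qed
  then have "p permutes UNIV" 
    using finite_UNIV_inj_surj[OF finite[of UNIV]] by (intro bij_imp_permutes) (auto simp: bij_def)
  moreover have "frame p = i"
  proof
    fix a show "frame p a = i a"
      using i bij_betw_inv_into_left[OF bij_betw_of_nat_7, of a]
      by (auto simp: frame_def p_def multi_index_def PiE_def extensional_def)
  qed
  ultimately show "i \<in> frame ` {p. p permutes UNIV}" by blast
qed

lemma inj_on_frame: "inj_on frame A"
proof (rule inj_onI)
  fix p q assume "frame p = frame q"
  then have "p (of_nat a) = q (of_nat a)" if "a < 7" for a
    using that unfolding frame_def by (metis lessThan_iff restrict_apply')
  then show "p = q"
    using bij_betw_imp_surj_on[OF bij_betw_of_nat_7] by (metis UNIV_I ext imageE lessThan_iff)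
qed

lemma sum_multi_index_7:
  assumes "\<And>i. i \<in> multi_index 7 \<Longrightarrow> \<not> inj_on i {..<7} \<Longrightarrow> f i = 0"
  shows "(\<Sum>i\<in>multi_index 7. f i) = (\<Sum>p | p permutes UNIV. f (frame p) :: real)"
proof -
  have "(\<Sum>i\<in>multi_index 7. f i) = (\<Sum>i\<in>frame ` {p. p permutes UNIV}. f i)"
    unfolding frame_image
    by (intro sum.mono_neutral_right) (use assms in \<open>auto simp: multi_index_def intro: finite_PiE\<close>)
  then show ?thesis by (simp add: sum.reindex[OF inj_on_frame])
qed

lemma std_vol_permutes:
  assumes "q permutes UNIV"
  shows "std_vol (\<lambda>a. if a < 7 then axis (frame q a) 1 else w (a - 7)) = of_int (sign q)"
proof -
  have "inv_into {..<7} of_nat (i :: 7) < 7" "of_nat (inv_into {..<7} of_nat i) = i" for i :: 7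
    using bij_betw_apply[OF bij_betw_inv_into[OF bij_betw_of_nat_7], of i]
      bij_betw_inv_into_right[OF bij_betw_of_nat_7, of i] by auto
  then have "std_vol (\<lambda>a. if a < 7 then axis (frame q a) 1 else w (a - 7)) =
      det (\<chi> i. (mat 1 :: real^7^7) $ q i)"
    by (auto simp: std_vol_def frame_def mat_def axis_def vec_eq_iff intro!: arg_cong[where f=det])
  also have "\<dots> = of_int (sign q)" using det_permute_rows[OF assms, of "mat 1 :: real^7^7"] by simp
  finally show ?thesis .
qed

text \<open>This is the Leibniz expansion of the determinant of \<open>H\<close> with its rows
  permuted by \<open>p\<close>; reindexing by composition with \<open>p\<close> brings out the
  sign.\<close>

lemma sum_sign_prod_permutes:
  fixes H :: "real^'n^'n"
  assumes p: "p permutes (UNIV :: 'n::finite set)"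
  shows "(\<Sum>q | q permutes UNIV. of_int (sign q) * (\<Prod>x\<in>UNIV. H $ p x $ q x)) = of_int (sign p) * det H"
proof -
  have "(\<Sum>q | q permutes UNIV. of_int (sign q) * (\<Prod>x\<in>UNIV. H $ p x $ q x)) =
      (\<Sum>q | q permutes UNIV. of_int (sign (q \<circ> p)) * (\<Prod>x\<in>UNIV. H $ p x $ (q \<circ> p) x))"
    by (rule sum_permutations_compose_right[OF p])
  also have "\<dots> = (\<Sum>q | q permutes UNIV. of_int (sign p) * (of_int (sign q) * (\<Prod>x\<in>UNIV. H $ x $ q x)))"
  proof (intro sum.cong refl)
    fix q assume "q \<in> {q. q permutes (UNIV :: 'n set)}"
    then have "sign (q \<circ> p) = sign q * sign p"
      using p by (intro sign_compose) (auto intro: permutes_imp_permutation)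
    moreover have "(\<Prod>x\<in>UNIV. H $ p x $ (q \<circ> p) x) = (\<Prod>x\<in>UNIV. H $ x $ q x)"
      using prod.permute[OF p, of "\<lambda>x. H $ x $ q x"] by (simp add: comp_def)
    ultimately show "of_int (sign (q \<circ> p)) * (\<Prod>x\<in>UNIV. H $ p x $ (q \<circ> p) x) =
        of_int (sign p) * (of_int (sign q) * (\<Prod>x\<in>UNIV. H $ x $ q x))" by simp
  qed
  finally show ?thesis by (simp add: det_def sum_distrib_left)
qed

text \<open>Form and volume both vanish on repeated indices, so the double sum runs over pairs of
  permutations. The signed sum over the second one is the determinant of the inverse metric times
  the sign of the first, which cancels the sign coming from \<open>\<alpha>\<close>; the
  \<open>7!\<close> equal terms absorb the division by \<open>fact 7\<close>.\<close>

lemma hodge_star_7: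
  assumes "depends_upto 7 \<alpha>" "antisym_form 7 \<alpha>"
  shows "hodge_star G 7 \<alpha> w = det (matrix_inv G) * sqrt (det G) * \<alpha> std_basis"
proof -
  define H where "H = matrix_inv G"
  let ?P = "{p. p permutes (UNIV :: 7 set)}"
  let ?vol = "\<lambda>j. riem_vol G (\<lambda>a. if a < 7 then axis (j a) 1 else w (a - 7))"
  let ?al = "\<lambda>i. \<alpha> (\<lambda>a. axis (i a) 1)"
  have al: "?al (frame p) = of_int (sign p) * \<alpha> std_basis" if "p \<in> ?P" for p
  proof -
    have "?al (frame p) = \<alpha> (\<lambda>a. axis (p (of_nat a)) 1)"
      using assms(1) unfolding depends_upto_def by (auto simp: frame_def)
    then show ?thesis using antisym_form_permutes[OF _ assms] that by simp
  qed
  have al0: "?al i = 0" if "\<not> inj_on i {..<7}" for i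
    using that antisym_form_eq_0[OF assms(2)] unfolding inj_on_def by (metis lessThan_iff)
  have vol0: "?vol j = 0" if "\<not> inj_on j {..<7}" for j
  proof -
    obtain a b where ab: "a < 7" "b < 7" "a \<noteq> b" "j a = j b"
      using \<open>\<not> inj_on j {..<7}\<close> unfolding inj_on_def by (metis lessThan_iff)
    have "det (\<chi> i. (\<lambda>a. if a < 7 then axis (j a) 1 else w (a - 7)) (inv_into {..<7} of_nat i) :: real^7^7) = 0"
    proof (rule det_identical_rows[of "of_nat a" "of_nat b"])
      show "(of_nat a :: 7) \<noteq> of_nat b"
        using ab bij_betw_imp_inj_on[OF bij_betw_of_nat_7] by (auto dest: inj_onD)
      show "row (of_nat a) (\<chi> i. (\<lambda>a. if a < 7 then axis (j a) 1 else w (a - 7)) (inv_into {..<7} of_nat i) :: real^7^7) =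
          row (of_nat b) (\<chi> i. (\<lambda>a. if a < 7 then axis (j a) 1 else w (a - 7)) (inv_into {..<7} of_nat i) :: real^7^7)"
        using ab bij_betw_inv_into_left[OF bij_betw_of_nat_7, of a]
          bij_betw_inv_into_left[OF bij_betw_of_nat_7, of b]
        by (simp add: row_def)
    qed
    then show ?thesis by (simp add: riem_vol_def std_vol_def)
  qed
  have pr: "(\<Prod>a<7. H $ frame p a $ frame q a) = (\<Prod>x\<in>UNIV. H $ p x $ q x)" for p q
    using prod.reindex_bij_betw[OF bij_betw_of_nat_7, of "\<lambda>x. H $ p x $ q x"] by (simp add: frame_def)
  have "(\<Sum>i\<in>multi_index 7. \<Sum>j\<in>multi_index 7. (\<Prod>a<7. H $ i a $ j a) * ?al i * ?vol j) =
      (\<Sum>p\<in>?P. \<Sum>q\<in>?P. (\<Prod>a<7. H $ frame p a $ frame q a) * ?al (frame p) * ?vol (frame q))"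
    by (subst sum_multi_index_7, simp add: al0, subst sum_multi_index_7, simp add: vol0, rule refl)
  also have "\<dots> = (\<Sum>p\<in>?P. \<Sum>q\<in>?P. (of_int (sign p) * \<alpha> std_basis * sqrt (det G)) *
      (of_int (sign q) * (\<Prod>x\<in>UNIV. H $ p x $ q x)))"
    by (intro sum.cong refl) (simp add: pr al riem_vol_def std_vol_permutes)
  also have "\<dots> = (\<Sum>p\<in>?P. \<alpha> std_basis * sqrt (det G) * det H)"
  proof (intro sum.cong refl)
    fix p assume p: "p \<in> ?P"
    have sq: "of_int (sign p) * of_int (sign p) = (1::real)"
      by (metis of_int_1 of_int_mult sign_idempotent)
    have "(\<Sum>q\<in>?P. (of_int (sign p) * \<alpha> std_basis * sqrt (det G)) *
        (of_int (sign q) * (\<Prod>x\<in>UNIV. H $ p x $ q x))) =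
        of_int (sign p) * \<alpha> std_basis * sqrt (det G) * (of_int (sign p) * det H)"
      using p by (simp only: sum_distrib_left[symmetric] sum_sign_prod_permutes mem_Collect_eq)
    also have "\<dots> = \<alpha> std_basis * sqrt (det G) * det H * (of_int (sign p) * of_int (sign p))"
      by (simp only: mult_ac)
    finally show "(\<Sum>q\<in>?P. (of_int (sign p) * \<alpha> std_basis * sqrt (det G)) *
        (of_int (sign q) * (\<Prod>x\<in>UNIV. H $ p x $ q x))) = \<alpha> std_basis * sqrt (det G) * det H"
      using sq by simp
  qed
  also have "\<dots> = fact 7 * (\<alpha> std_basis * sqrt (det G) * det H)"
    using card_permutations[of "UNIV :: 7 set" 7] by simp
  finally show ?thesis unfolding hodge_star_def H_def by simp
qed

section \<open>The metric of a positive 3-form\<close>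

text \<open>Exchanging the two blocks of slots is a product of two transpositions, hence even. The
  symmetry of \<open>Q_form\<close> rests on this.\<close>

lemma wedge_2_2_commute:
  assumes "depends_upto 2 \<alpha>" "depends_upto 2 \<beta>"
  shows "wedge 2 2 \<alpha> \<beta> = wedge 2 2 \<beta> \<alpha>"
proof
  fix v :: "nat \<Rightarrow> vec7"
  let ?s = "Transposition.transpose 0 2 \<circ> Transposition.transpose 1 (3::nat)"
  let ?F = "\<lambda>\<alpha> \<beta> (p :: nat \<Rightarrow> nat). of_int (sign p) * \<alpha> (\<lambda>i. v (p i)) * \<beta> (\<lambda>i. v (p (2 + i))) :: real"
  have s: "?s permutes {..<2 + 2 :: nat}"
    by (intro permutes_compose permutes_swap_id) auto
  have "sign ?s = 1"
    by (subst sign_compose) (auto simp: sign_swap_id intro: permutation_swap_id)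
  have "(\<Sum>p | p permutes {..<2 + 2}. ?F \<alpha> \<beta> p) = (\<Sum>p | p permutes {..<2 + 2}. ?F \<alpha> \<beta> (p \<circ> ?s))"
    by (rule sum_permutations_compose_right[OF s])
  also have "\<dots> = (\<Sum>p | p permutes {..<2 + 2}. ?F \<beta> \<alpha> p)"
  proof (intro sum.cong refl)
    fix p assume "p \<in> {p. p permutes {..<2 + 2 :: nat}}"
    then have "sign (p \<circ> ?s) = sign p"
      using s \<open>sign ?s = 1\<close> by (subst sign_compose) (auto intro: permutes_imp_permutation[of "{..<2+2}"])
    moreover have "\<alpha> (\<lambda>i. v ((p \<circ> ?s) i)) = \<alpha> (\<lambda>i. v (p (2 + i)))"
      by (intro assms(1)[unfolded depends_upto_def, rule_format])
        (drule less_2_cases, auto simp: Transposition.transpose_def eval_nat_numeral)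
    moreover have "\<beta> (\<lambda>i. v ((p \<circ> ?s) (2 + i))) = \<beta> (\<lambda>i. v (p i))"
      by (intro assms(2)[unfolded depends_upto_def, rule_format])
        (drule less_2_cases, auto simp: Transposition.transpose_def eval_nat_numeral)
    ultimately show "?F \<alpha> \<beta> (p \<circ> ?s) = ?F \<beta> \<alpha> p" by simp
  qed
  finally show "wedge 2 2 \<alpha> \<beta> v = wedge 2 2 \<beta> \<alpha> v" unfolding wedge_def by simp
qed

lemma linear_wedge_left:
  assumes "\<And>v. linear (\<lambda>a. \<alpha> a v)"
  shows "linear (\<lambda>a. wedge k l (\<alpha> a) \<beta> v)"
proof (rule linearI)
  show "wedge k l (\<alpha> (a + b)) \<beta> v = wedge k l (\<alpha> a) \<beta> v + wedge k l (\<alpha> b) \<beta> v" for a b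
    unfolding wedge_def linear_add[OF assms] by (simp add: algebra_simps sum.distrib add_divide_distrib)
  show "wedge k l (\<alpha> (c *\<^sub>R a)) \<beta> v = c *\<^sub>R wedge k l (\<alpha> a) \<beta> v" for c a
    unfolding wedge_def linear_cmul[OF assms] by (simp add: sum_distrib_left mult_ac)
qed

lemma alternating_form_depends_upto: "alternating_form k \<alpha> \<Longrightarrow> depends_upto k \<alpha>"
  by (simp add: alternating_form_def depends_upto_def)

lemma depends_upto_contract:
  assumes "depends_upto (Suc k) \<phi>"
  shows "depends_upto k (contract a \<phi>)"
  unfolding depends_upto_def contract_def
  by (intro allI impI assms[unfolded depends_upto_def, rule_format]) (simp split: nat.split)

lemma linear_contract:
  assumes "alternating_form (Suc k) \<phi>"
  shows "linear (\<lambda>a. contract a \<phi> v)"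
proof -
  \<comment> \<open>Recasts the first slot as a function update, the shape in which
    \<open>alternating_form\<close> states linearity.\<close>
  have "contract a \<phi> v = \<phi> ((case_nat 0 v)(0 := a))" for a
    unfolding contract_def by (rule arg_cong[where f=\<phi>]) (auto simp: fun_eq_iff split: nat.split)
  moreover have "linear (\<lambda>a. \<phi> ((case_nat 0 v)(0 := a)))"
    using assms unfolding alternating_form_def by blast
  ultimately show ?thesis by simp
qed

context
  fixes \<phi> :: form7
  assumes \<phi>: "alternating_form 3 \<phi>"
begin

lemma depends_upto_contract_3form: "depends_upto 2 (contract a \<phi>)"
  using alternating_form_depends_upto[OF \<phi>] by (simp add: depends_upto_contract eval_nat_numeral)

lemma Q_form_sym: "Q_form \<phi> a b = Q_form \<phi> b a"
  unfolding Q_form_def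
  by (simp only: wedge_2_2_commute[OF depends_upto_contract_3form depends_upto_contract_3form, of a b])

lemma linear_Q_form_left: "linear (\<lambda>a. Q_form \<phi> a b v)"
  unfolding Q_form_def
  by (intro linear_wedge_left linear_contract[of 2]) (use \<phi> in \<open>simp add: eval_nat_numeral\<close>)

lemma linear_Q_form_right: "linear (\<lambda>b. Q_form \<phi> a b v)"
  using linear_Q_form_left by (subst Q_form_sym)

lemma depends_upto_Q_form: "depends_upto 7 (Q_form \<phi> a b)"
proof -
  have "depends_upto (2 + 2) (wedge 2 2 (contract a \<phi>) (contract b \<phi>))"
    by (intro depends_upto_wedge depends_upto_contract_3form)
  then have "depends_upto (4 + 3) (Q_form \<phi> a b)"
    unfolding Q_form_def using alternating_form_depends_upto[OF \<phi>] by (intro depends_upto_wedge) auto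
  then show ?thesis by simp
qed

lemma hodge_star_Q_form:
  "hodge_star G 7 (Q_form \<phi> a b) w = det (matrix_inv G) * sqrt (det G) * Q_form \<phi> a b std_basis"
  using antisym_form_wedge[of 4 3] by (intro hodge_star_7 depends_upto_Q_form) (simp add: Q_form_def)

end

section \<open>The explicit solution of 6 g = *Q\<close>

definition Q_matrix :: "form7 \<Rightarrow> real^7^7" where
  "Q_matrix \<phi> = (\<chi> i j. Q_form \<phi> (axis i 1) (axis j 1) std_basis / 6)"

lemma inner_Q_matrix:
  assumes \<phi>: "alternating_form 3 \<phi>"
  shows "6 * (a \<bullet> (Q_matrix \<phi> *v b)) = Q_form \<phi> a b std_basis"
proof -
  let ?Q = "\<lambda>a b. Q_form \<phi> a b std_basis"
  have "?Q a b = ?Q (\<Sum>i\<in>UNIV. a $ i *\<^sub>R axis i 1) (\<Sum>j\<in>UNIV. b $ j *\<^sub>R axis j 1)"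
    using basis_expansion[of a] basis_expansion[of b] by (simp add: scalar_mult_eq_scaleR)
  also have "\<dots> = (\<Sum>i\<in>UNIV. a $ i * (\<Sum>j\<in>UNIV. b $ j * ?Q (axis i 1) (axis j 1)))"
    unfolding linear_sum[OF linear_Q_form_left[OF \<phi>]] linear_cmul[OF linear_Q_form_left[OF \<phi>]]
    unfolding linear_sum[OF linear_Q_form_right[OF \<phi>]] linear_cmul[OF linear_Q_form_right[OF \<phi>]]
    by simp
  finally show ?thesis
    by (simp add: inner_vec_def matrix_vector_mult_def Q_matrix_def sum_distrib_left mult_ac)
qed

lemma inner_product_Q_matrix:
  assumes "alternating_form 3 \<phi>" "positive_3form \<phi>"
  shows "inner_product_matrix (Q_matrix \<phi>)"
  unfolding inner_product_matrix_def
proof (intro conjI allI impI)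
  show "transpose (Q_matrix \<phi>) = Q_matrix \<phi>"
    using Q_form_sym[OF assms(1)] by (simp add: vec_eq_iff transpose_def Q_matrix_def)
  show "v \<bullet> (Q_matrix \<phi> *v v) > 0" if "v \<noteq> 0" for v
    using inner_Q_matrix[OF assms(1), of v v] assms(2) that unfolding positive_3form_def by fastforce
qed

lemma inner_axis_matrix: "axis i 1 \<bullet> (G *v axis j 1) = (G :: real^'n^'m) $ i $ j"
  by (simp add: inner_axis' matrix_vector_mult_basis column_def)

lemma det_scaled:
  fixes A :: "real^'n^'n"
  shows "det (\<chi> i j. c * A $ i $ j) = c ^ CARD('n) * det A"
  using det_rows_mul[of "\<lambda>_. c" "\<lambda>i. A $ i"]
  by (simp add: vector_scalar_mult_def)

text \<open>Since \<open>6 g = *Q\<close> means \<open>sqrt (det g) g = q\<close>, taking determinants gives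
  \<open>(det g)\<^bsup>9/2\<^esup> = det q\<close>.\<close>

lemma G2_metric_eq:
  assumes "alternating_form 3 \<phi>" "positive_3form \<phi>"
  defines "s \<equiv> det (Q_matrix \<phi>) powr (- 1 / 9)"
  shows "G2_metric \<phi> = (\<chi> i j. s * Q_matrix \<phi> $ i $ j)"
    and "inner_product_matrix (G2_metric \<phi>)"
proof -
  let ?q = "Q_matrix \<phi>"
  let ?G = "\<chi> i j. s * ?q $ i $ j"
  let ?P = "\<lambda>G. inner_product_matrix G \<and>
     (\<forall>a b. 6 * (a \<bullet> (G *v b)) = hodge_star G 7 (Q_form \<phi> a b) (\<lambda>_. 0))"
  have q: "inner_product_matrix ?q" by (rule inner_product_Q_matrix[OF assms(1,2)])
  have d: "det ?q > 0" by (rule inner_product_matrix_det_pos[OF q])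
  have s: "s > 0" using d by (simp add: s_def)
  \<comment> \<open>The inverse determinant and the volume factor combine to the power -1 + 1/2 of
    \<open>det G\<close>, which turns \<open>6 g = *Q\<close> into a matrix equation.\<close>
  have star: "hodge_star G 7 (Q_form \<phi> a b) w = det G powr (- 1 / 2) * Q_form \<phi> a b std_basis"
    if "inner_product_matrix G" for G a b w
  proof -
    have D: "det G > 0" by (rule inner_product_matrix_det_pos[OF that])
    have "det (matrix_inv G) = det G powr (-1)"
      unfolding det_matrix_inv[OF inner_product_matrix_invertible[OF that]] powr_minus_divide
      using D by simp
    moreover have "sqrt (det G) = det G powr (1 / 2)"
      using D by (simp add: powr_half_sqrt)
    ultimately have "det (matrix_inv G) * sqrt (det G) = det G powr (-1) * det G powr (1 / 2)" by simp
    also have "\<dots> = det G powr (- 1 / 2)"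
      by (subst powr_add[symmetric]) simp
    finally show ?thesis by (simp add: hodge_star_Q_form[OF assms(1)])
  qed
  have mv: "?G *v b = s *\<^sub>R (?q *v b)" for b
    by (simp add: vec_eq_iff matrix_vector_mult_def sum_distrib_left mult.assoc)
  have G: "inner_product_matrix ?G"
    unfolding inner_product_matrix_def mv
  proof (intro conjI allI impI)
    show "transpose ?G = ?G"
      using q by (auto simp: inner_product_matrix_def vec_eq_iff transpose_def)
    show "v \<bullet> s *\<^sub>R (?q *v v) > 0" if "v \<noteq> 0" for v
      using q s that by (auto simp: inner_product_matrix_def)
  qed
  \<comment> \<open>\<open>det ?G\<close> is \<open>det ?q\<close> to the power -7/9 + 1 = 2/9, and
    the power -1/2 of this has exponent -1/9, that of \<open>s\<close>.\<close>
  have "det ?G powr (- 1 / 2) = s"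
  proof -
    have "det ?G = s powr 7 * det ?q" using s by (simp add: det_scaled powr_numeral)
    also have "\<dots> = det ?q powr (2 / 9)"
      using powr_add[of "det ?q" "- 7 / 9" 1] d by (simp add: s_def powr_powr)
    finally show ?thesis by (simp add: s_def powr_powr)
  qed
  then have "?P ?G"
    using G by (simp add: star[OF G] mv inner_Q_matrix[OF assms(1), symmetric])
  \<comment> \<open>Any solution is \<open>k\<close> times \<open>?q\<close>, with \<open>k\<close>
    given by its own determinant; comparing determinants then pins down \<open>k\<close>.\<close>
  moreover have "G' = ?G" if "?P G'" for G'
  proof -
    have G': "inner_product_matrix G'" using that by blast
    define k where "k = det G' powr (- 1 / 2)"
    have D: "det G' > 0" by (rule inner_product_matrix_det_pos[OF G'])
    have e: "G' $ i $ j = k * ?q $ i $ j" for i j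
    proof -
      have "6 * (axis i 1 \<bullet> (G' *v axis j 1)) = k * (6 * (axis i 1 \<bullet> (?q *v axis j 1)))"
        using that star[OF G'] unfolding inner_Q_matrix[OF assms(1)] k_def by metis
      then show ?thesis unfolding inner_axis_matrix by simp
    qed
    then have "G' = (\<chi> i j. k * ?q $ i $ j)" by (simp add: vec_eq_iff)
    then have "det G' = k ^ 7 * det ?q" using det_scaled[of k ?q] by simp
    also have "k ^ 7 = det G' powr (- 7 / 2)"
      using D powr_power[of "det G'" "- 1 / 2" 7] by (simp add: k_def)
    finally have "det G' powr (7 / 2) * det G' = (det G' powr (7 / 2) * det G' powr (- 7 / 2)) * det ?q"
      by (simp only: mult.assoc)
    also have "det G' powr (7 / 2) * det G' powr (- 7 / 2) = 1"
      using D by (subst powr_add[symmetric]) simp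
    finally have "det G' powr (7 / 2) * det G' = det ?q" by simp
    then have "det ?q = det G' powr (9 / 2)"
      using powr_add[of "det G'" "7 / 2" 1] D by simp
    then have "k = s" by (simp add: s_def k_def powr_powr)
    with e show ?thesis by (simp add: vec_eq_iff)
  qed
  ultimately have "G2_metric \<phi> = ?G" unfolding G2_metric_def by (intro the_equality)
  with G show "G2_metric \<phi> = ?G" "inner_product_matrix (G2_metric \<phi>)" by simp_all
qed

section \<open>Smoothness of the energy density\<close>

lemma smooth_on_wedge:
  assumes "open S" "\<And>v. smooth_on S (\<lambda>z. \<alpha> z v)" "\<And>v. smooth_on S (\<lambda>z. \<beta> z v)"
  shows "smooth_on S (\<lambda>z. wedge k l (\<alpha> z) (\<beta> z) v)"
  unfolding wedge_def
  by (intro smooth_on_divide_const smooth_on_sum smooth_on_mult smooth_on_const assms)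

lemma smooth_on_Q_form:
  assumes "open S" "\<And>v. smooth_on S (\<lambda>z. \<phi> z v)"
  shows "smooth_on S (\<lambda>z. Q_form (\<phi> z) a b v)"
proof -
  have "smooth_on S (\<lambda>z. contract a (\<phi> z) v)" for a v
    unfolding contract_def by (rule assms)
  then show ?thesis unfolding Q_form_def by (intro smooth_on_wedge assms)
qed

lemma smooth_on_det:
  fixes M :: "'a::real_normed_vector \<Rightarrow> real^'n^'n"
  assumes "open S" "\<And>i j. smooth_on S (\<lambda>z. M z $ i $ j)"
  shows "smooth_on S (\<lambda>z. det (M z))"
  unfolding det_def
  by (intro smooth_on_sum smooth_on_mult smooth_on_const smooth_on_prod assms)

text \<open>\<open>matrix_inv\<close> is a choice operator; as quotients of determinants its entries
  become visibly smooth where the determinant is positive.\<close>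

lemma matrix_inv_cramer:
  fixes M :: "real^'n^'n"
  assumes "det M > 0"
  shows "matrix_inv M $ i $ j = det (\<chi> k l. if l = i then axis j 1 $ k else M $ k $ l) / det M"
proof -
  have inv: "invertible M" using assms by (simp add: invertible_det_nz)
  have "M *v (matrix_inv M *v axis j 1) = axis j 1"
    by (simp add: matrix_vector_mul_assoc matrix_inv_right[OF inv])
  then have "matrix_inv M *v axis j 1 =
      (\<chi> i. det (\<chi> k l. if l = i then axis j 1 $ k else M $ k $ l) / det M)"
    using cramer[of M] assms by simp
  then show ?thesis by (simp add: matrix_vector_mult_basis column_def vec_eq_iff)
qed

lemma smooth_on_matrix_inv:
  fixes M :: "'a::real_normed_vector \<Rightarrow> real^'n^'n"
  assumes "open S" "\<And>i j. smooth_on S (\<lambda>z. M z $ i $ j)" "\<And>z. z \<in> S \<Longrightarrow> det (M z) > 0"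
  shows "smooth_on S (\<lambda>z. matrix_inv (M z) $ i $ j)"
proof (rule smooth_on_cong[OF assms(1)])
  show "smooth_on S (\<lambda>z. det (\<chi> k l. if l = i then axis j 1 $ k else M z $ k $ l) / det (M z))"
  proof (intro smooth_on_divide smooth_on_det assms)
    show "smooth_on S (\<lambda>z. (\<chi> k l. if l = i then axis j 1 $ k else M z $ k $ l) $ k $ l)" for k l
      using assms by (cases "l = i") (auto intro: smooth_on_const)
  qed
qed (simp add: matrix_inv_cramer assms(3))

lemma smooth_on_hodge_star:
  assumes "open S" "\<And>i j. smooth_on S (\<lambda>z. G z $ i $ j)" "\<And>z. z \<in> S \<Longrightarrow> det (G z) > 0"
    "\<And>v. smooth_on S (\<lambda>z. \<alpha> z v)"
  shows "smooth_on S (\<lambda>z. hodge_star (G z) k (\<alpha> z) w)"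
  unfolding hodge_star_def riem_vol_def
  by (intro smooth_on_divide_const smooth_on_sum smooth_on_mult smooth_on_const smooth_on_prod
      smooth_on_matrix_inv smooth_on_sqrt smooth_on_det assms)

lemma smooth_on_form_inner:
  assumes "open S" "\<And>i j. smooth_on S (\<lambda>z. G z $ i $ j)" "\<And>z. z \<in> S \<Longrightarrow> det (G z) > 0"
    "\<And>v. smooth_on S (\<lambda>z. \<alpha> z v)" "\<And>v. smooth_on S (\<lambda>z. \<beta> z v)"
  shows "smooth_on S (\<lambda>z. form_inner (G z) k (\<alpha> z) (\<beta> z))"
  unfolding form_inner_def
  by (intro smooth_on_divide_const smooth_on_sum smooth_on_mult smooth_on_prod
      smooth_on_matrix_inv assms)

text \<open>\<open>Q_matrix\<close> is polynomial in the components of the form, and positivity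
  keeps its determinant in the range where the power -1/9 is smooth.\<close>

lemma smooth_on_G2_metric:
  assumes "open S" "\<And>v. smooth_on S (\<lambda>z. \<phi> z v)"
    "\<And>z. z \<in> S \<Longrightarrow> alternating_form 3 (\<phi> z)" "\<And>z. z \<in> S \<Longrightarrow> positive_3form (\<phi> z)"
  shows "smooth_on S (\<lambda>z. G2_metric (\<phi> z) $ i $ j)"
proof (rule smooth_on_cong[OF assms(1)])
  have q: "smooth_on S (\<lambda>z. Q_matrix (\<phi> z) $ i $ j)" for i j
    unfolding Q_matrix_def using assms by (simp add: smooth_on_divide_const smooth_on_Q_form)
  show "smooth_on S (\<lambda>z. det (Q_matrix (\<phi> z)) powr (- 1 / 9) * Q_matrix (\<phi> z) $ i $ j)"
    by (intro smooth_on_mult smooth_on_powr smooth_on_det q assms(1)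
        inner_product_matrix_det_pos inner_product_Q_matrix assms(3,4))
qed (simp add: G2_metric_eq(1)[OF assms(3,4)])

lemma smooth_on_ext_deriv:
  assumes "open I" "open U" "\<And>v. smooth_on (I \<times> U) (\<lambda>(t, x). \<omega> t c x v)"
  shows "smooth_on (I \<times> U) (\<lambda>(t, x). ext_deriv k (\<omega> t) c x v)"
proof -
  have "smooth_on (I \<times> U) (\<lambda>z. frechet_derivative
      (\<lambda>y. \<omega> (fst z) c y (\<lambda>j. v (if j < i then j else Suc j))) (at (snd z)) (v i))" for i
    using smooth_on_partial_snd[OF assms(1,2), where F="\<lambda>t y. \<omega> t c y (\<lambda>j. v (if j < i then j else Suc j))"]
      assms(3) by (simp add: case_prod_unfold)
  then show ?thesis
    unfolding ext_deriv_def case_prod_unfold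
    by (intro smooth_on_sum smooth_on_mult smooth_on_const open_Times assms)
qed

text \<open>The value of the energy 7-form on \<open>std_basis\<close> is its density against
  Lebesgue measure in the chart, the quantity that \<open>dform_integral\<close> integrates.\<close>

definition energy_density :: "'m dform \<Rightarrow> 'm chart \<Rightarrow> vec7 \<Rightarrow> real" where
  "energy_density \<phi> c x =
     form_inner (G2_metric (\<phi> c x)) 2 (codifferential \<phi> 3 \<phi> c x) (codifferential \<phi> 3 \<phi> c x) *
     dform_star \<phi> 0 (\<lambda>_ _ _. 1) c x std_basis"

text \<open>A path of positive 3-forms read in one chart. Time and position form a single variable
  in \<open>I \<times> U\<close>, because \<open>d\<close> differentiates in position and the result
  must still be smooth in time.\<close>

locale smooth_G2_path_chart =
  fixes I :: "real set" and U :: "vec7 set" and c :: "'m chart" and \<phi> :: "real \<Rightarrow> 'm dform"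
  assumes open_I: "open I" and open_U: "open U"
    and smooth: "\<And>v. smooth_on (I \<times> U) (\<lambda>(t, x). \<phi> t c x v)"
    and alternating: "\<And>t x. t \<in> I \<Longrightarrow> x \<in> U \<Longrightarrow> alternating_form 3 (\<phi> t c x)"
    and positive: "\<And>t x. t \<in> I \<Longrightarrow> x \<in> U \<Longrightarrow> positive_3form (\<phi> t c x)"
begin

lemma inner_product_metric:
  "t \<in> I \<Longrightarrow> x \<in> U \<Longrightarrow> inner_product_matrix (G2_metric (\<phi> t c x))"
  using alternating positive by (intro G2_metric_eq(2))

lemma smooth_on_metric: "smooth_on (I \<times> U) (\<lambda>z. G2_metric (\<phi> (fst z) c (snd z)) $ i $ j)"
  using smooth alternating positive open_I open_U
  by (intro smooth_on_G2_metric) (auto simp: case_prod_unfold open_Times)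

lemma smooth_on_dform_star:
  assumes "\<And>v. smooth_on (I \<times> U) (\<lambda>(t, x). \<omega> t c x v)"
  shows "smooth_on (I \<times> U) (\<lambda>(t, x). dform_star (\<phi> t) k (\<omega> t) c x v)"
  unfolding dform_star_def case_prod_unfold
  using assms open_I open_U
  by (intro smooth_on_hodge_star smooth_on_metric inner_product_matrix_det_pos inner_product_metric)
    (auto simp: case_prod_unfold open_Times)

lemma smooth_on_codifferential:
  assumes "\<And>v. smooth_on (I \<times> U) (\<lambda>(t, x). \<omega> t c x v)"
  shows "smooth_on (I \<times> U) (\<lambda>(t, x). codifferential (\<phi> t) k (\<omega> t) c x v)"
proof -
  have "smooth_on (I \<times> U) (\<lambda>(t, x).
      dform_star (\<phi> t) (8 - k) (ext_deriv (7 - k) (dform_star (\<phi> t) k (\<omega> t))) c x v)"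
    by (intro smooth_on_dform_star smooth_on_ext_deriv open_I open_U assms)
  then show ?thesis
    unfolding codifferential_def case_prod_unfold
    by (intro smooth_on_mult smooth_on_const open_Times open_I open_U)
qed

lemma smooth_on_energy_density: "smooth_on (I \<times> U) (\<lambda>(t, x). energy_density (\<phi> t) c x)"
proof -
  have op: "open (I \<times> U)" using open_I open_U by (rule open_Times)
  have det: "det (G2_metric (\<phi> (fst z) c (snd z))) > 0" if "z \<in> I \<times> U" for z
    using that by (cases z) (simp add: inner_product_matrix_det_pos inner_product_metric)
  \<comment> \<open>The constant 0-form is written as a constant path to fit
    \<open>smooth_on_dform_star\<close>.\<close>
  have "smooth_on (I \<times> U) (\<lambda>(t, x). dform_star (\<phi> t) 0 ((\<lambda>_ _ _ _. 1) t) c x std_basis)"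
    by (intro smooth_on_dform_star) (simp add: case_prod_unfold smooth_on_const op)
  then have vol: "smooth_on (I \<times> U)
      (\<lambda>z. dform_star (\<phi> (fst z)) 0 (\<lambda>_ _ _. 1) c (snd z) std_basis)"
    by (simp add: case_prod_unfold)
  have cod: "smooth_on (I \<times> U) (\<lambda>z. codifferential (\<phi> (fst z)) 3 (\<phi> (fst z)) c (snd z) v)" for v
    using smooth_on_codifferential[of \<phi>, OF smooth] by (simp add: case_prod_unfold)
  show ?thesis
    unfolding energy_density_def case_prod_unfold
    by (rule smooth_on_mult[OF op smooth_on_form_inner[OF op smooth_on_metric det cod cod] vol])
qed

text \<open>The standard frame has standard volume 1, so the volume factor is the positive number
  \<open>sqrt (det g)\<close> and the norm decides the sign.\<close>

lemma energy_density_nonneg: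
  assumes "t \<in> I" "x \<in> U"
  shows "energy_density (\<phi> t) c x \<ge> 0"
proof -
  have "dform_star (\<phi> t) 0 (\<lambda>_ _ _. 1) c x std_basis = sqrt (det (G2_metric (\<phi> t c x))) * std_vol std_basis"
    by (simp add: dform_star_def hodge_star_one riem_vol_def)
  also have "std_vol std_basis = det (mat 1 :: real^7^7)"
    using bij_betw_inv_into_right[OF bij_betw_of_nat_7]
    by (auto simp: std_vol_def std_basis_def mat_def axis_def vec_eq_iff intro!: arg_cong[where f=det])
  finally show ?thesis
    using form_inner_nonneg[OF inner_product_metric[OF assms]]
      inner_product_matrix_det_pos[OF inner_product_metric[OF assms]]
    by (simp add: energy_density_def)
qed

end

section \<open>The energy as a sum of integrals over charts\<close>

text \<open>A compact Hausdorff space is normal, so Urysohn functions provide bumps; finitely many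
  of them cover, and division by their sum normalises. This ensures that the \<open>SOME\<close> in
  \<open>dform_integral\<close> picks a genuine partition.\<close>

lemma finite_partition_of_unity_exists:
  fixes U :: "'c \<Rightarrow> 'm::t2_space set"
  assumes "compact (UNIV :: 'm set)" and op: "\<And>c. c \<in> A \<Longrightarrow> open (U c)" and cov: "(\<Union>c\<in>A. U c) = UNIV"
  obtains C \<rho> where "finite C" "C \<subseteq> A" "\<And>c. c \<in> C \<Longrightarrow> continuous_on UNIV (\<rho> c)"
    "\<And>c p. c \<in> C \<Longrightarrow> \<rho> c p \<ge> (0::real)" "\<And>c. c \<in> C \<Longrightarrow> closure {p. \<rho> c p \<noteq> 0} \<subseteq> U c"
    "\<And>p. (\<Sum>c\<in>C. \<rho> c p) = 1"
proof -
  have "Hausdorff_space (euclidean :: 'm topology)"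
    unfolding Hausdorff_space_def disjnt_def using hausdorff by fastforce
  then have normal: "normal_space (euclidean :: 'm topology)"
    using assms(1) by (intro compact_Hausdorff_or_regular_imp_normal_space)
      (auto simp: compact_space_def)
  have "\<exists>c g. c \<in> A \<and> continuous_on UNIV g \<and> (\<forall>q. g q \<ge> (0::real)) \<and> closure {q. g q \<noteq> 0} \<subseteq> U c \<and> g p > 0"
    for p :: 'm
  proof -
    obtain c where c: "c \<in> A" "p \<in> U c" using cov by blast
    obtain f where f: "continuous_map euclidean euclideanreal f" "f ` {p} \<subseteq> {1}" "f ` (- U c) \<subseteq> {0}"
      by (rule Urysohn_lemma_alt[OF normal, of "{p}" "- U c" 1 0])
        (use op[OF c(1)] c(2) in \<open>auto simp: disjnt_def\<close>)
    have cf: "continuous_on UNIV f" using f(1) by simp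
    \<comment> \<open>Cutting off at height 1/2 keeps the closed support inside \<open>U c\<close>;
      the closure of the set where \<open>f\<close> is nonzero might leave it.\<close>
    let ?g = "\<lambda>q. max 0 (f q - 1/2)"
    have "closure {q. ?g q \<noteq> 0} \<subseteq> {q. f q \<ge> 1/2}"
    proof (rule closure_minimal)
      show "closed {q. f q \<ge> 1/2}"
        using continuous_closed_vimage[of "{1/2..}" f] cf
        by (simp add: continuous_on_eq_continuous_at vimage_def)
    qed auto
    also have "\<dots> \<subseteq> U c"
    proof
      fix q assume "q \<in> {q. f q \<ge> 1/2}"
      then show "q \<in> U c" using f(3) by (cases "q \<in> U c") auto
    qed
    finally show ?thesis
      using c f(2) cf by (intro exI[of _ c] exI[of _ ?g]) (auto intro!: continuous_intros)
  qed
  then obtain c g where cg: "\<And>p. c p \<in> A" "\<And>p. continuous_on UNIV (g p)" "\<And>p q. g p q \<ge> (0::real)"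
      "\<And>p. closure {q. g p q \<noteq> 0} \<subseteq> U (c p)" "\<And>p. g p p > 0"
    by metis
  have "open {q. g p q > 0}" for p
    using open_vimage[OF open_greaterThan[of 0] cg(2)[of p]] by (simp add: vimage_def)
  moreover have "UNIV \<subseteq> (\<Union>p\<in>UNIV. {q. g p q > 0})" using cg(5) by auto
  ultimately obtain P where P: "finite P" "UNIV \<subseteq> (\<Union>p\<in>P. {q. g p q > 0})"
    using compactE_image[OF assms(1), of UNIV "\<lambda>p. {q. g p q > 0}"] by metis
  define T where "T q = (\<Sum>p\<in>P. g p q)" for q
  have T: "T q > 0" for q
  proof -
    obtain p where "p \<in> P" "g p q > 0" using P(2) by blast
    then show ?thesis unfolding T_def using cg(3) P(1) by (intro sum_pos2[of P p]) auto
  qed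
  \<comment> \<open>Several bumps may sit in one chart, while the partition is indexed by charts, so
    they are added up chart by chart.\<close>
  define \<rho> where "\<rho> d q = (\<Sum>p | p \<in> P \<and> c p = d. g p q) / T q" for d q
  show ?thesis
  proof
    show "finite (c ` P)" "c ` P \<subseteq> A" using P(1) cg(1) by auto
    show "continuous_on UNIV (\<rho> d)" for d
      unfolding \<rho>_def T_def
      by (intro continuous_intros cg(2)) (use T in \<open>auto simp: T_def less_le\<close>)
    show "\<rho> d q \<ge> 0" for d q
      unfolding \<rho>_def using T[of q] by (intro divide_nonneg_pos sum_nonneg cg(3)) auto
    show "closure {q. \<rho> d q \<noteq> 0} \<subseteq> U d" for d
    proof -
      have "{q. \<rho> d q \<noteq> 0} \<subseteq> (\<Union>p\<in>{p\<in>P. c p = d}. {q. g p q \<noteq> 0})"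
        unfolding \<rho>_def by (auto elim: sum.not_neutral_contains_not_neutral)
      then have "closure {q. \<rho> d q \<noteq> 0} \<subseteq> (\<Union>p\<in>{p\<in>P. c p = d}. closure {q. g p q \<noteq> 0})"
        using P(1) by (intro closure_minimal) (auto intro!: closed_UN intro: subsetD[OF closure_subset])
      also have "\<dots> \<subseteq> U d" using cg(4) by blast
      finally show ?thesis .
    qed
    show "(\<Sum>d\<in>c ` P. \<rho> d q) = 1" for q
    proof -
      have "(\<Sum>d\<in>c ` P. \<rho> d q) = (\<Sum>d\<in>c ` P. \<Sum>p | p \<in> P \<and> c p = d. g p q) / T q"
        unfolding \<rho>_def sum_divide_distrib ..
      also have "\<dots> = T q / T q"
        unfolding T_def using P(1) by (simp add: sum.image_gen[symmetric])
      finally show ?thesis using T[of q] by simp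
    qed
  qed
qed

lemma compact_chart_image:
  fixes c :: "'m::t2_space chart"
  assumes "compact (UNIV :: 'm set)" "is_chart c" "closed S" "S \<subseteq> chart_dom c"
  shows "compact (snd c ` S)"
proof -
  have "continuous_on (chart_dom c) (snd c)"
    using assms(2) homeomorphism_cont1 unfolding is_chart_def by blast
  moreover have "compact S" using compact_Int_closed[OF assms(1,3)] by simp
  ultimately show ?thesis using assms(4) by (blast intro: compact_continuous_image continuous_on_subset)
qed

text \<open>The closed support of \<open>\<rho>\<close> is compact because the manifold is, and the
  chart carries it to a compact subset of the chart image, as the cutoff requires.\<close>

lemma DERIV_chart_integral:
  fixes c :: "'m::t2_space chart"
  assumes "compact (UNIV :: 'm set)" and c: "is_chart c"
    and \<rho>: "continuous_on UNIV \<rho>" "closure {p. \<rho> p \<noteq> 0} \<subseteq> chart_dom c"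
    and f: "smooth_on ({a<..<b} \<times> chart_img c) (\<lambda>(t, x). f t x)"
    and t: "t \<in> {a<..<b}"
  shows "((\<lambda>s. integral (chart_img c) (\<lambda>x. \<rho> (chart_inv c x) * f s x)) has_real_derivative
      integral (chart_img c) (\<lambda>x. \<rho> (chart_inv c x) *
        frechet_derivative (\<lambda>(t, x). f t x) (at (t, x)) (1, 0))) (at t)"
proof (rule DERIV_integral_smooth[OF _ _ _ f _ _ t])
  have h: "homeomorphism (chart_dom c) (chart_img c) (snd c) (chart_inv c)"
    using c by (simp add: is_chart_def)
  let ?K = "snd c ` closure {p. \<rho> p \<noteq> 0}"
  show "open (chart_img c)" using c by (simp add: is_chart_def)
  show "compact ?K" using assms(1) c \<rho>(2) by (intro compact_chart_image) auto
  show "?K \<subseteq> chart_img c" using \<rho>(2) unfolding chart_img_def by (rule image_mono)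
  show "continuous_on (chart_img c) (\<lambda>x. \<rho> (chart_inv c x))"
    by (rule continuous_on_compose2[OF \<rho>(1) homeomorphism_cont2[OF h]]) simp
  show "\<rho> (chart_inv c x) = 0" if "x \<in> chart_img c" "x \<notin> ?K" for x
  proof (rule ccontr)
    assume "\<rho> (chart_inv c x) \<noteq> 0"
    then have "chart_inv c x \<in> closure {p. \<rho> p \<noteq> 0}" by (intro subsetD[OF closure_subset]) simp
    moreover have "x = snd c (chart_inv c x)" using homeomorphism_apply2[OF h that(1)] by simp
    ultimately have "x \<in> ?K" by (rule rev_image_eqI)
    with that(2) show False ..
  qed
qed

lemma partition_of_unity_exists:
  fixes A :: "'m::t2_space chart set"
  assumes "compact (UNIV :: 'm set)" "oriented_smooth_atlas A"
  shows "\<exists>C \<rho>. partition_of_unity A C \<rho>"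
proof -
  have "open (chart_dom c)" if "c \<in> A" for c
    using assms(2) that by (auto simp: oriented_smooth_atlas_def is_chart_def)
  moreover have "(\<Union>c\<in>A. chart_dom c) = UNIV"
    using assms(2) by (simp add: oriented_smooth_atlas_def)
  ultimately obtain C and \<rho> :: "'m chart \<Rightarrow> 'm \<Rightarrow> real" where
    "finite C" "C \<subseteq> A" "\<And>c. c \<in> C \<Longrightarrow> continuous_on UNIV (\<rho> c)"
    "\<And>c p. c \<in> C \<Longrightarrow> \<rho> c p \<ge> 0" "\<And>c. c \<in> C \<Longrightarrow> closure {p. \<rho> c p \<noteq> 0} \<subseteq> chart_dom c"
    "\<And>p. (\<Sum>c\<in>C. \<rho> c p) = 1"
    by (rule finite_partition_of_unity_exists[OF assms(1), of A chart_dom]) (assumption | rule that)+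
  then have "partition_of_unity A C \<rho>" by (simp add: partition_of_unity_def)
  then show ?thesis by blast
qed

text \<open>The choice made in \<open>dform_integral\<close> depends on the atlas alone, so one
  \<open>C\<close> and \<open>\<rho>\<close> serve all forms, in particular all times of a
  path.\<close>

lemma dirichlet_energy_local_sum:
  fixes A :: "'m::t2_space chart set"
  assumes "compact (UNIV :: 'm set)" "oriented_smooth_atlas A"
  obtains C \<rho> where "partition_of_unity A C \<rho>"
    "\<And>\<phi>. dirichlet_energy A \<phi> =
      (\<Sum>c\<in>C. integral (chart_img c) (\<lambda>x. \<rho> c (chart_inv c x) * energy_density \<phi> c x))"
proof -
  define P where "P = (SOME (C, \<rho>). partition_of_unity A C \<rho>)"
  have "case P of (C, \<rho>) \<Rightarrow> partition_of_unity A C \<rho>"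
    unfolding P_def by (rule someI_ex) (use partition_of_unity_exists[OF assms] in auto)
  moreover have "dirichlet_energy A \<phi> = (case P of (C, \<rho>) \<Rightarrow>
      \<Sum>c\<in>C. integral (chart_img c) (\<lambda>x. \<rho> c (chart_inv c x) * energy_density \<phi> c x))" for \<phi>
    unfolding dirichlet_energy_def dform_integral_def energy_density_def P_def by simp
  ultimately show ?thesis using that[of "fst P" "snd P"] by (simp add: case_prod_unfold)
qed

lemma deRham_class_closed:
  assumes "cl \<in> deRham_cohomology A k" "\<omega> \<in> cl"
  shows "closed_dform A k \<omega>"
  using assms unfolding deRham_cohomology_def by (auto elim!: quotientE)

lemma energy_density_eq_0:
  assumes "torsion_free A \<phi>" "c \<in> A" "x \<in> chart_img c"
  shows "energy_density \<phi> c x = 0"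
  using assms by (simp add: energy_density_def form_inner_def torsion_free_def dform_eq_def)

text \<open>\<open>deriv\<close> is total, and where no derivative exists its value carries no
  information. The differentiability claims make the inequality one about a genuine second
  derivative.\<close>

theorem proposition5p19:
  fixes A :: "'m::t2_space chart set"
    and cl :: "'m dform set"
    and \<phi> :: "real \<Rightarrow> 'm dform"
    and \<epsilon> :: real
  assumes "compact (UNIV :: 'm set)"
    and "oriented_smooth_atlas A"
    and "cl \<in> deRham_cohomology A 3"
    and "G2_structures A cl \<noteq> {}"
    and "\<epsilon> > 0"
    and "\<forall>t\<in>{-\<epsilon><..<\<epsilon>}. \<phi> t \<in> G2_structures A cl"
    and "smooth_path_on A {-\<epsilon><..<\<epsilon>} \<phi>"
    and "torsion_free A (\<phi> 0)"
  shows "(\<forall>t\<in>{-\<epsilon><..<\<epsilon>}. (\<lambda>s. dirichlet_energy A (\<phi> s)) field_differentiable at t) \<and>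
    deriv (\<lambda>s. dirichlet_energy A (\<phi> s)) field_differentiable at 0 \<and>
    deriv (deriv (\<lambda>s. dirichlet_energy A (\<phi> s))) 0 \<ge> 0"
proof -
  let ?I = "{-\<epsilon><..<\<epsilon>}"
  let ?E = "\<lambda>s. dirichlet_energy A (\<phi> s)"
  have chart: "is_chart c" if "c \<in> A" for c
    using assms(2) that by (simp add: oriented_smooth_atlas_def)
  have path: "smooth_G2_path_chart ?I (chart_img c) c \<phi>" if "c \<in> A" for c
  proof
    show "open (chart_img c)" using chart[OF that] by (simp add: is_chart_def)
    show "smooth_on (?I \<times> chart_img c) (\<lambda>(t, x). \<phi> t c x v)" for v
      using assms(7) that by (simp add: smooth_path_on_def)
    fix t x assume tx: "t \<in> ?I" "x \<in> chart_img c"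
    have t: "\<phi> t \<in> G2_structures A cl" using assms(6) tx(1) by blast
    then show "positive_3form (\<phi> t c x)" using that tx(2) by (simp add: G2_structures_def)
    have "closed_dform A 3 (\<phi> t)"
      using t by (intro deRham_class_closed[OF assms(3)]) (simp add: G2_structures_def)
    then show "alternating_form 3 (\<phi> t c x)"
      using that tx(2) by (simp add: closed_dform_def differential_form_def)
  qed simp
  obtain C \<rho> where part: "partition_of_unity A C \<rho>"
    and E: "\<And>\<phi>. dirichlet_energy A \<phi> =
      (\<Sum>c\<in>C. integral (chart_img c) (\<lambda>x. \<rho> c (chart_inv c x) * energy_density \<phi> c x))"
    by (rule dirichlet_energy_local_sum[OF assms(1,2)]) (rule that)
  have C: "c \<in> A" "continuous_on UNIV (\<rho> c)" "\<rho> c p \<ge> 0" "closure {p. \<rho> c p \<noteq> 0} \<subseteq> chart_dom c"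
    if "c \<in> C" for c p
    using part that unfolding partition_of_unity_def by blast+
  \<comment> \<open>Stated for an arbitrary family \<open>f\<close> because it is applied to the
    density and again to its time derivative.\<close>
  have DERIV_sum_charts: "((\<lambda>s. \<Sum>c\<in>C. integral (chart_img c) (\<lambda>x. \<rho> c (chart_inv c x) * f c s x))
      has_real_derivative (\<Sum>c\<in>C. integral (chart_img c) (\<lambda>x. \<rho> c (chart_inv c x) *
        frechet_derivative (\<lambda>(t, x). f c t x) (at (t, x)) (1, 0)))) (at t)"
    if "\<And>c. c \<in> A \<Longrightarrow> smooth_on (?I \<times> chart_img c) (\<lambda>(t, x). f c t x)" "t \<in> ?I" for f t
    using C that by (intro DERIV_sum DERIV_chart_integral assms(1) chart) auto
  let ?e' = "\<lambda>c t x. frechet_derivative (\<lambda>(t, x). energy_density (\<phi> t) c x) (at (t, x)) (1, 0)"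
  let ?e'' = "\<lambda>c t x. frechet_derivative (\<lambda>(t, x). ?e' c t x) (at (t, x)) (1, 0)"
  define E' where "E' t = (\<Sum>c\<in>C. integral (chart_img c) (\<lambda>x. \<rho> c (chart_inv c x) * ?e' c t x))" for t
  define D where "D = (\<Sum>c\<in>C. integral (chart_img c) (\<lambda>x. \<rho> c (chart_inv c x) * ?e'' c 0 x))"
  have smooth: "smooth_on (?I \<times> chart_img c) (\<lambda>(t, x). energy_density (\<phi> t) c x)" if "c \<in> A" for c
    using smooth_G2_path_chart.smooth_on_energy_density[OF path[OF that]] .
  then have smooth': "smooth_on (?I \<times> chart_img c) (\<lambda>(t, x). ?e' c t x)" if "c \<in> A" for c
    using smooth_on_frechet_derivative[OF smooth[OF that]] by (simp add: case_prod_unfold)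
  have dE: "(?E has_real_derivative E' t) (at t)" if "t \<in> ?I" for t
    unfolding E E'_def by (rule DERIV_sum_charts[OF smooth that])
  have dE': "(E' has_real_derivative D) (at 0)"
    unfolding E'_def[abs_def] D_def by (rule DERIV_sum_charts[OF smooth']) (use assms(5) in auto)
  \<comment> \<open>\<open>deriv ?E\<close> is identified with \<open>E'\<close> only on the open
    interval, which is enough for a derivative at 0.\<close>
  have "(deriv ?E has_real_derivative D) (at 0)"
    by (rule has_field_derivative_transform_within_open[OF dE', of ?I])
      (use assms(5) DERIV_imp_deriv[OF dE] in auto)
  moreover have "D \<ge> 0"
  proof (rule second_deriv_nonneg_at_min[OF assms(5) _ dE'])
    show "(?E has_real_derivative E' t) (at t)" if "\<bar>t - 0\<bar> < \<epsilon>" for t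
      using that by (intro dE) auto
    have "?E 0 = 0"
      unfolding E
    proof (intro sum.neutral ballI)
      fix c assume c: "c \<in> C"
      have "integral (chart_img c) (\<lambda>x. \<rho> c (chart_inv c x) * energy_density (\<phi> 0) c x) =
          integral (chart_img c) (\<lambda>_. 0)"
        using C(1)[OF c] by (intro integral_cong) (simp add: energy_density_eq_0[OF assms(8)])
      then show "integral (chart_img c) (\<lambda>x. \<rho> c (chart_inv c x) * energy_density (\<phi> 0) c x) = 0" by simp
    qed
    moreover have "?E t \<ge> 0" if "\<bar>t - 0\<bar> < \<epsilon>" for t
      unfolding E
    proof (rule sum_nonneg)
      fix c assume c: "c \<in> C"
      show "integral (chart_img c) (\<lambda>x. \<rho> c (chart_inv c x) * energy_density (\<phi> t) c x) \<ge> 0"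
      \<comment> \<open>The integral of a non-integrable function is 0 by convention, so the sign is
        right in either case.\<close>
      proof (cases "(\<lambda>x. \<rho> c (chart_inv c x) * energy_density (\<phi> t) c x) integrable_on chart_img c")
        case True
        then show ?thesis
          using C(3)[OF c] smooth_G2_path_chart.energy_density_nonneg[OF path[OF C(1)[OF c]], of t] that
          by (intro integral_nonneg) (auto simp: abs_less_iff)
      qed (simp add: not_integrable_integral)
    qed
    ultimately show "?E 0 \<le> ?E t" if "\<bar>t - 0\<bar> < \<epsilon>" for t using that by simp
  qed
  ultimately show ?thesis
    unfolding field_differentiable_def using dE by (metis DERIV_imp_deriv)
qed

end
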